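(* Let $K$ be an algebraically closed field of characteristic zero, $d\ge1$, $n=\left[\frac d2\right]$, and let $$q=Z_0x^d+\binom d1 Z_1x^{d-1}y+\dots+\binom d{d-1}Z_{d-1}xy^{d-1}+Z_dy^d$$ be a nonzero binary form of degree $d$ over $K$. Let $N$ be the $(d-n+1)\times(n+1)$ matrix $N=(Z_{i+j})_{0\le i\le d-n,\ 0\le j\le n}$, and define $k$ by $k+1=\operatorname{rank} N$ (rank as a matrix). Then: (i) $q\in\overline{S_{d,k+1}}\setminus\overline{S_{d,k}}$. (ii) If $d=2n$ and $k=n$, then $\operatorname{rank} q=k+1=d-k+1$. (iii) Otherwise, let $M$ be the $(d-k)\times(k+2)$ matrix $M=(Z_{i+j})_{0\le i\le d-k-1,\ 0\le j\le k+1}$. Then $M$ has rank $k+1$, so that there is a nonzero solution $(f_0,\dots,f_{k+1})^{T}$, unique up to scalars, of the linear system $M\cdot(f_0,f_1,\dots,f_{k+1})^{T}=0$. Put $f=f_0x^{k+1}+f_1x^ky+\dots+f_kxy^k+f_{k+1}y^{k+1}$. If $f$ has no multiple roots in $\mathbb{P}^1(K)$, then $\operatorname{rank} q=k+1$; otherwise $\operatorname{rank} q=d-k+1$. Moreover, if $f$ has $k+1$ distinct roots $[t_1,u_1],\dots,[t_{k+1},u_{k+1}]\in\mathbb{P}^1(K)$, then $q$ is a linear combination of the $d$th powers of the linear forms $t_1x+u_1y,\dots,t_{k+1}x+u_{k+1}y$.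
   Context: $S_d$ is the $K$-vector space of homogeneous polynomials of degree $d$ in two variables $x,y$ (binary forms), with $S_1$ the linear forms. The rank of a form $q\in S_d$ is the least integer $r\ge 1$ such that $q=L_1^d+\dots+L_r^d$ with $L_i\in S_1$ (zero linear forms allowed, so the zero form has rank $1$). $S_{d,r}=\{q\in S_d:\operatorname{rank} q=r\}$, the bar denotes Zariski closure in $S_d$, and $\overline{S_{d,0}}=\emptyset$. $[\cdot]$ applied to a number is its integer part. *)

theory Defs
  imports "Jordan_Normal_Form.DL_Rank"
begin

text \<open>
  The polynomial ring K[x,y] is \<open>'a poly poly\<close>, read as K[x][y]: the coefficient of
  x^i y^j in \<open>p\<close> is \<open>coeff (coeff p j) i\<close>.
\<close>

definition var_x :: "'a::field poly poly" where
  "var_x = [:[:0, 1:]:]"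

definition var_y :: "'a::field poly poly" where
  "var_y = [:0, 1:]"

definition const :: "'a::field \<Rightarrow> 'a poly poly" where
  "const c = [:[:c:]:]"

definition eval_form :: "'a::field poly poly \<Rightarrow> 'a \<Rightarrow> 'a \<Rightarrow> 'a" where
  "eval_form p a b = poly (poly p [:b:]) a"

definition binary_forms :: "nat \<Rightarrow> 'a::field poly poly set" where
  "binary_forms d = {p. \<forall>i j. coeff (coeff p j) i \<noteq> 0 \<longrightarrow> i + j = d}"

definition form_rank :: "nat \<Rightarrow> 'a::field poly poly \<Rightarrow> nat" where
  "form_rank d q =
     (LEAST r. 1 \<le> r \<and>
        (\<exists>L :: nat \<Rightarrow> 'a poly poly. (\<forall>i<r. L i \<in> binary_forms 1) \<and> q = (\<Sum>i<r. L i ^ d)))"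

definition forms_of_rank :: "nat \<Rightarrow> nat \<Rightarrow> 'a::field poly poly set" where
  "forms_of_rank d r = {q \<in> binary_forms d. form_rank d q = r}"

text \<open>
  Polynomial functions on the affine space of forms of degree d: the K-algebra generated by
  the d + 1 coordinate functions.
\<close>

inductive polynomial_fun :: "nat \<Rightarrow> ('a::field poly poly \<Rightarrow> 'a) \<Rightarrow> bool" for d :: nat where
  const_fun: "polynomial_fun d (\<lambda>q. c)"
| coordinate: "j \<le> d \<Longrightarrow> polynomial_fun d (\<lambda>q. coeff (coeff q j) (d - j))"
| add: "polynomial_fun d \<phi> \<Longrightarrow> polynomial_fun d \<psi> \<Longrightarrow> polynomial_fun d (\<lambda>q. \<phi> q + \<psi> q)"
| mult: "polynomial_fun d \<phi> \<Longrightarrow> polynomial_fun d \<psi> \<Longrightarrow> polynomial_fun d (\<lambda>q. \<phi> q * \<psi> q)"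

definition zariski_closed :: "nat \<Rightarrow> 'a::field poly poly set \<Rightarrow> bool" where
  "zariski_closed d A \<longleftrightarrow>
     (\<exists>\<Phi>. (\<forall>\<phi>\<in>\<Phi>. polynomial_fun d \<phi>) \<and> A = {q \<in> binary_forms d. \<forall>\<phi>\<in>\<Phi>. \<phi> q = 0})"

definition zariski_closure :: "nat \<Rightarrow> 'a::field poly poly set \<Rightarrow> 'a poly poly set" where
  "zariski_closure d A = zariski_closed d hull A"

text \<open>Points of the projective line are given by homogeneous coordinates.\<close>

definition homogeneous_coords :: "'a::field \<times> 'a \<Rightarrow> bool" where
  "homogeneous_coords P \<longleftrightarrow> P \<noteq> (0, 0)"

definition same_point :: "'a::field \<times> 'a \<Rightarrow> 'a \<times> 'a \<Rightarrow> bool" where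
  "same_point P Q \<longleftrightarrow> (\<exists>c. c \<noteq> 0 \<and> fst Q = c * fst P \<and> snd Q = c * snd P)"

definition is_root :: "'a::field poly poly \<Rightarrow> 'a \<times> 'a \<Rightarrow> bool" where
  "is_root f P \<longleftrightarrow> homogeneous_coords P \<and> eval_form f (fst P) (snd P) = 0"

text \<open>The linear form vanishing at [a,b] is b x - a y.\<close>

definition is_multiple_root :: "'a::field poly poly \<Rightarrow> 'a \<times> 'a \<Rightarrow> bool" where
  "is_multiple_root f P \<longleftrightarrow>
     homogeneous_coords P \<and> (const (snd P) * var_x - const (fst P) * var_y)\<^sup>2 dvd f"

definition hankel_mat :: "(nat \<Rightarrow> 'a) \<Rightarrow> nat \<Rightarrow> nat \<Rightarrow> 'a mat" where
  "hankel_mat Z r c = mat r c (\<lambda>(i, j). Z (i + j))"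

definition mat_rank :: "'a::field mat \<Rightarrow> nat" where
  "mat_rank A = vec_space.rank (dim_row A) A"

end

theory Submission
  imports Defs
begin

text \<open>
  Write a form of degree \<open>d\<close> as \<open>\<Sum>i. (d choose i) Z\<^sub>i x^(d-i) y^i\<close> and regard \<open>Z\<close> as the linear functional
  \<open>x^(d-i) y^i \<mapsto> Z\<^sub>i\<close> on forms of degree \<open>d\<close>. The \<open>d\<close>th power of \<open>t x + u y\<close> is then evaluation at
  \<open>(t, u)\<close>, so that the rank of the form is the number of point evaluations into which the functional
  decomposes. A form \<open>g\<close> of degree \<open>s\<close> annihilates \<open>Z\<close> if the functional vanishes on all multiples
  of \<open>g\<close> of degree \<open>d\<close>; this says that the coefficient vector of \<open>g\<close> is in the kernel of a Hankel
  matrix of \<open>Z\<close>. A squarefree annihilator of degree \<open>s\<close> decomposes the functional into evaluations at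
  its \<open>s\<close> roots, and conversely (\<open>apolarity\<close>, \<open>annihilates_power_sum\<close>): the rank of a nonzero
  form is the least degree of a squarefree annihilator.

  The annihilators form an ideal with two coprime generators, \<open>f\<close> of the minimal degree \<open>a\<close> and \<open>g\<close> of
  degree \<open>d + 2 - a\<close> (\<open>minimal_annihilator_dvd\<close>, \<open>coprime_annihilator_exists\<close>). In degrees below
  \<open>d + 2 - a\<close> there are thus only multiples of \<open>f\<close>, and counting them gives \<open>a\<close> as the rank of the
  Hankel matrices \<open>N\<close> and \<open>M\<close> (\<open>rank_hankel\<close>), so \<open>a = k + 1\<close>. If \<open>f\<close> is squarefree, the rank of \<open>q\<close> is
  \<open>k + 1\<close>. Otherwise no squarefree annihilator has degree below \<open>d + 2 - a = d - k + 1\<close>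
  (\<open>double_root_lower_bound\<close>), while in that degree the pencil spanned by \<open>g\<close> and a multiple of \<open>f\<close>
  contains a squarefree form (\<open>power_sum_upper_bound\<close>). If \<open>d = 2 n\<close> and \<open>k = n\<close>, both generators have
  degree \<open>k + 1\<close>.

  For the closures, sums of at most \<open>k\<close> powers are killed by the minors of size \<open>k + 1\<close> of a Hankel
  matrix, and a combination of these is nonzero at \<open>q\<close> (\<open>rank_detector\<close>). On the other hand, moving
  the roots of \<open>f\<close> apart, \<open>q\<close> moves in a polynomial family whose general member is annihilated
  by a squarefree form of degree \<open>k + 1\<close> (\<open>annihilated_family\<close>, \<open>in_closure_forms_of_rank\<close>).

  A form of degree \<open>s\<close> is represented by the univariate polynomial of degree at most \<open>s\<close> obtained from
  \<open>x = 1\<close>. The formal degree \<open>s\<close> is carried along separately, and a drop of the degree is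
  a root at infinity.
\<close>

section \<open>Forms, functionals and annihilators\<close>

text \<open>
  The linear form that vanishes at \<open>P\<close>, with \<open>x = 1\<close>. At infinity, for \<open>P = (0, b)\<close>, it is
  the constant \<open>b\<close>: multiplication by it raises the formal degree but not the degree.
\<close>

definition lin :: "'a::field \<times> 'a \<Rightarrow> 'a poly" where
  "lin P = [:snd P, - fst P:]"

text \<open>
  The linear functional on forms of degree \<open>d\<close> that sends \<open>x^(d-j) y^j\<close> to \<open>Z j\<close>. Up to the
  factor \<open>d!\<close> it is the action of \<open>g\<close>, as a differential operator with constant coefficients, on
  the form \<open>\<Sum>j\<le>d. (d choose j) Z\<^sub>j x^(d-j) y^j\<close>. The Hankel matrices of \<open>Z\<close> are the
  matrices of the pairings \<open>(g, h) \<mapsto> apol Z (g * h)\<close>.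
\<close>

definition apol :: "(nat \<Rightarrow> 'a::field) \<Rightarrow> 'a poly \<Rightarrow> 'a" where
  "apol Z g = (\<Sum>j\<le>degree g. coeff g j * Z j)"

text \<open>
  The sequence of the \<open>d\<close>th power of the linear form with coefficients \<open>P\<close>; as a functional it
  is evaluation at \<open>P\<close> (\<open>form_eval\<close>).
\<close>

definition power_seq :: "nat \<Rightarrow> 'a::field \<times> 'a \<Rightarrow> nat \<Rightarrow> 'a" where
  "power_seq d P j = fst P ^ (d - j) * snd P ^ j"

definition form_eval :: "nat \<Rightarrow> 'a::field poly \<Rightarrow> 'a \<times> 'a \<Rightarrow> 'a" where
  "form_eval d g P = apol (power_seq d P) g"

text \<open>
  Membership in the degree-\<open>s\<close> part of the apolar ideal. For \<open>s > d\<close> no test form \<open>h\<close> exists, so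
  that every form of degree \<open>s\<close> annihilates, as it should.
\<close>

definition annihilates :: "nat \<Rightarrow> (nat \<Rightarrow> 'a::field) \<Rightarrow> nat \<Rightarrow> 'a poly \<Rightarrow> bool" where
  "annihilates d Z s g \<longleftrightarrow> degree g \<le> s \<and> (\<forall>h. degree h + s \<le> d \<longrightarrow> apol Z (g * h) = 0)"

text \<open>
  Contraction with the linear form \<open>lin P\<close>: the functional \<open>g \<mapsto> apol Z (lin P * g)\<close> on forms
  of degree one less. All inductions below descend along it.
\<close>

definition contract :: "'a::field \<times> 'a \<Rightarrow> (nat \<Rightarrow> 'a) \<Rightarrow> nat \<Rightarrow> 'a" where
  "contract P Z j = snd P * Z j - fst P * Z (Suc j)"

lemma apol_bound:
  assumes "degree g \<le> m"
  shows "apol Z g = (\<Sum>j\<le>m. coeff g j * Z j)"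
  unfolding apol_def using assms
  by (intro sum.mono_neutral_left) (auto simp: coeff_eq_0)

lemma apol_0 [simp]: "apol Z 0 = 0"
  by (simp add: apol_def)

lemma apol_add: "apol Z (g + h) = apol Z g + apol Z h"
proof -
  let ?m = "max (degree g) (degree h)"
  have "apol Z (g + h) = (\<Sum>j\<le>?m. coeff (g + h) j * Z j)"
    by (rule apol_bound) (rule degree_add_le_max)
  moreover have "apol Z g = (\<Sum>j\<le>?m. coeff g j * Z j)" "apol Z h = (\<Sum>j\<le>?m. coeff h j * Z j)"
    by (auto intro: apol_bound)
  ultimately show ?thesis by (simp add: algebra_simps sum.distrib)
qed

lemma apol_smult: "apol Z (Polynomial.smult c g) = c * apol Z g"
  using apol_bound[of "Polynomial.smult c g" "degree g" Z] degree_smult_le[of c g]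
  by (simp add: apol_def sum_distrib_left mult.assoc)

lemma apol_diff: "apol Z (g - h) = apol Z g - apol Z h"
  using apol_add[of Z "g - h" h] by simp

lemma apol_sum: "apol Z (sum g A) = (\<Sum>i\<in>A. apol Z (g i))"
  by (induction A rule: infinite_finite_induct) (auto simp: apol_add)

lemma apol_monom: "apol Z (Polynomial.monom c j) = c * Z j"
proof -
  have "apol Z (Polynomial.monom c j) = (\<Sum>i\<le>j. coeff (Polynomial.monom c j) i * Z i)"
    by (rule apol_bound) (rule degree_monom_le)
  also have "\<dots> = (\<Sum>i\<le>j. if i = j then c * Z j else 0)"
    by (rule sum.cong) auto
  finally show ?thesis by simp
qed

lemma apol_pCons: "apol Z (pCons c g) = c * Z 0 + apol (\<lambda>j. Z (Suc j)) g"
proof -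
  have "apol Z (pCons c g) = (\<Sum>j\<le>Suc (degree g). coeff (pCons c g) j * Z j)"
    by (rule apol_bound) (simp add: degree_pCons_le)
  also have "\<dots> = c * Z 0 + (\<Sum>j\<le>degree g. coeff g j * Z (Suc j))"
    by (subst sum.atMost_Suc_shift) simp
  finally show ?thesis by (simp add: apol_def)
qed

lemma apol_cong:
  assumes "degree g \<le> d" "\<And>j. j \<le> d \<Longrightarrow> Z j = Y j"
  shows "apol Z g = apol Y g"
  using assms unfolding apol_bound[OF assms(1)] by auto

lemma apol_lin_seq:
  "apol (\<lambda>j. a * Z j + b * Y j) g = a * apol Z g + b * apol Y g"
  by (simp add: apol_def algebra_simps sum.distrib sum_distrib_left)

lemma lin_eq_0_iff [simp]: "lin P = 0 \<longleftrightarrow> P = (0, 0)"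
  by (cases P) (auto simp: lin_def)

lemma degree_lin_le: "degree (lin P) \<le> 1"
  by (simp add: lin_def)

lemma lin_mult: "lin P * g = Polynomial.smult (snd P) g - Polynomial.smult (fst P) (pCons 0 g)"
  by (simp add: lin_def)

lemma degree_lin_mult: "degree g \<le> s \<Longrightarrow> degree (lin P * g) \<le> Suc s"
  using degree_mult_le[of "lin P" g] degree_lin_le[of P] by linarith

lemma apol_contract: "apol (contract P Z) g = apol Z (lin P * g)"
proof -
  have "apol (contract P Z) g = snd P * apol Z g + (- fst P) * apol (\<lambda>j. Z (Suc j)) g"
    using apol_lin_seq[of "snd P" Z "- fst P" "\<lambda>j. Z (Suc j)" g]
    by (simp add: contract_def[abs_def])
  thus ?thesis by (simp add: lin_mult apol_diff apol_smult apol_pCons)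
qed

lemma annihilates_degree: "annihilates d Z s g \<Longrightarrow> degree g \<le> s"
  by (simp add: annihilates_def)

lemma annihilatesD: "annihilates d Z s g \<Longrightarrow> degree h + s \<le> d \<Longrightarrow> apol Z (g * h) = 0"
  by (simp add: annihilates_def)

lemma annihilates_smult: "annihilates d Z s g \<Longrightarrow> annihilates d Z s (Polynomial.smult c g)"
  using degree_smult_le[of c g] by (auto simp: annihilates_def apol_smult)

lemma annihilates_add:
  "annihilates d Z s g \<Longrightarrow> annihilates d Z s h \<Longrightarrow> annihilates d Z s (g + h)"
  by (auto simp: annihilates_def apol_add ring_distribs degree_add_le)

lemma annihilates_diff:
  "annihilates d Z s g \<Longrightarrow> annihilates d Z s h \<Longrightarrow> annihilates d Z s (g - h)"
  by (auto simp: annihilates_def apol_diff ring_distribs degree_diff_le)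

lemma annihilates_mult:
  assumes "annihilates d Z a f" "degree h + a \<le> s"
  shows "annihilates d Z s (f * h)"
  unfolding annihilates_def
proof safe
  show "degree (f * h) \<le> s"
    using assms degree_mult_le[of f h] annihilates_degree[OF assms(1)] by linarith
  fix h' :: "'a poly" assume "degree h' + s \<le> d"
  hence "degree (h * h') + a \<le> d" using degree_mult_le[of h h'] assms(2) by linarith
  thus "apol Z (f * h * h') = 0" using annihilatesD[OF assms(1)] by (metis mult.assoc)
qed

lemma annihilates_contract_lin:
  "annihilates (Suc d) Z (Suc s) (lin P * g) \<Longrightarrow> degree g \<le> s \<Longrightarrow> annihilates d (contract P Z) s g"
  by (auto simp: annihilates_def apol_contract mult.assoc)

lemma annihilates_lin_contract:
  "annihilates d (contract P Z) s g \<Longrightarrow> annihilates (Suc d) Z (Suc s) (lin P * g)"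
  by (auto simp: annihilates_def apol_contract mult.assoc degree_lin_mult)

lemma annihilates_contract:
  assumes "annihilates (Suc d) Z s g"
  shows "annihilates d (contract P Z) s g"
  unfolding annihilates_def
proof safe
  show "degree g \<le> s" using assms by (rule annihilates_degree)
  fix h :: "'a poly" assume "degree h + s \<le> d"
  hence "degree (lin P * h) + s \<le> Suc d" using degree_lin_mult[of h "degree h" P] by linarith
  hence "apol Z (g * (lin P * h)) = 0" by (rule annihilatesD[OF assms])
  thus "apol (contract P Z) (g * h) = 0" by (simp add: apol_contract mult.left_commute)
qed

lemma annihilates_degree_0:
  assumes "annihilates d Z 0 f" "f \<noteq> 0" "degree g \<le> d"
  shows "apol Z g = 0"
proof -
  obtain c where c: "f = [:c:]" using annihilates_degree[OF assms(1)] degree0_coeffs by blast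
  show ?thesis using annihilatesD[OF assms(1), of g] assms(2,3) c by (simp add: apol_smult)
qed

lemma poly_altdef_le:
  fixes g :: "'a::field poly"
  assumes "degree g \<le> m"
  shows "poly g z = (\<Sum>j\<le>m. coeff g j * z ^ j)"
  unfolding Polynomial.poly_altdef by (intro sum.mono_neutral_left) (use assms in \<open>auto simp: coeff_eq_0\<close>)

lemma form_eval_bound:
  "degree g \<le> m \<Longrightarrow> form_eval d g P = (\<Sum>j\<le>m. coeff g j * (fst P ^ (d - j) * snd P ^ j))"
  by (simp add: form_eval_def apol_bound power_seq_def)

lemma form_eval_affine:
  assumes "degree g \<le> d" "fst P \<noteq> 0"
  shows "form_eval d g P = fst P ^ d * poly g (snd P / fst P)"
proof -
  have "form_eval d g P = (\<Sum>j\<le>d. coeff g j * (fst P ^ (d - j) * snd P ^ j))"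
    by (rule form_eval_bound[OF assms(1)])
  also have "\<dots> = (\<Sum>j\<le>d. fst P ^ d * (coeff g j * (snd P / fst P) ^ j))"
    using assms(2) by (intro sum.cong) (auto simp: power_divide power_diff)
  also have "\<dots> = fst P ^ d * poly g (snd P / fst P)"
    by (simp add: poly_altdef_le[OF assms(1)] sum_distrib_left)
  finally show ?thesis .
qed

lemma form_eval_infinity:
  assumes "degree g \<le> d"
  shows "form_eval d g (0, b) = coeff g d * b ^ d"
proof -
  have "form_eval d g (0, b) = (\<Sum>j\<le>d. if j = d then coeff g d * b ^ d else 0)"
    unfolding form_eval_bound[OF assms] by (intro sum.cong) auto
  thus ?thesis by simp
qed

lemma form_eval_mult:
  assumes "degree g \<le> s" "degree h \<le> t"
  shows "form_eval (s + t) (g * h) P = form_eval s g P * form_eval t h P"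
proof -
  have deg: "degree (g * h) \<le> s + t" using assms degree_mult_le[of g h] by linarith
  show ?thesis
  proof (cases "fst P = 0")
    case False
    thus ?thesis using assms deg by (simp add: form_eval_affine power_add)
  next
    case True
    then obtain b where P: "P = (0, b)" by (cases P) auto
    have "coeff (g * h) (s + t) = (\<Sum>i\<le>s + t. coeff g i * coeff h (s + t - i))"
      by (simp add: coeff_mult)
    also have "\<dots> = (\<Sum>i\<le>s + t. if i = s then coeff g s * coeff h t else 0)"
    proof (intro sum.cong refl)
      fix i show "coeff g i * coeff h (s + t - i) = (if i = s then coeff g s * coeff h t else 0)"
        using assms by (cases i s rule: linorder_cases) (auto simp: coeff_eq_0)
    qed
    finally have "coeff (g * h) (s + t) = coeff g s * coeff h t" by simp
    thus ?thesis using assms deg P by (simp add: form_eval_infinity power_add)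
  qed
qed

lemma form_eval_1: "form_eval 0 1 P = 1"
  by (simp add: form_eval_def apol_def power_seq_def)

lemma form_eval_diff: "form_eval s (g - h) P = form_eval s g P - form_eval s h P"
  by (simp add: form_eval_def apol_diff)

lemma form_eval_smult: "form_eval s (Polynomial.smult c g) P = c * form_eval s g P"
  by (simp add: form_eval_def apol_smult)

lemma form_eval_power:
  "degree g \<le> 1 \<Longrightarrow> form_eval n (g ^ n) P = form_eval 1 g P ^ n"
proof (induction n)
  case (Suc n)
  have "degree (g ^ n) \<le> n" using Suc.prems degree_power_le[of g n] by (metis le_trans mult.commute mult_le_mono1 mult_1)
  thus ?case using form_eval_mult[of g 1 "g ^ n" n P] Suc by simp
qed (simp add: form_eval_1)

lemma form_eval_lin: "form_eval 1 (lin P) Q = snd P * fst Q - fst P * snd Q"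
  using form_eval_bound[OF degree_lin_le, of 1 P Q] by (simp add: lin_def)

lemma form_eval_lin_mult:
  "degree g \<le> s \<Longrightarrow> form_eval (Suc s) (lin P * g) Q = (snd P * fst Q - fst P * snd Q) * form_eval s g Q"
  using form_eval_mult[OF degree_lin_le, of g s P Q] form_eval_lin[of P Q] by simp

text \<open>
  Roots at infinity need no separate treatment: there the leading coefficient vanishes and
  \<open>lin P\<close> is constant, so that the quotient has smaller formal degree.
\<close>

lemma form_root_factor:
  assumes "degree g \<le> Suc s" "form_eval (Suc s) g P = 0" "P \<noteq> (0, 0)"
  obtains h where "degree h \<le> s" "g = lin P * h"
proof (cases "fst P = 0")
  case False
  have "poly g (snd P / fst P) = 0" using assms(1,2) False by (simp add: form_eval_affine)
  then obtain h where h: "g = [:- (snd P / fst P), 1:] * h" using poly_eq_0_iff_dvd by blast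
  have g: "g = lin P * Polynomial.smult (- (1 / fst P)) h"
    unfolding h using False by (intro poly_eqI) (auto simp: lin_def coeff_pCons field_simps split: nat.split)
  have "degree (Polynomial.smult (- (1 / fst P)) h) \<le> s"
  proof (cases "h = 0")
    case hn: False
    have "degree g = Suc (degree h)" unfolding h by (subst degree_mult_eq) (use hn in auto)
    thus ?thesis using assms(1) False by simp
  qed simp
  thus ?thesis using g that by blast
next
  case True
  then obtain b where P: "P = (0, b)" by (cases P) auto
  with assms(3) have b: "b \<noteq> 0" by auto
  have "coeff g (Suc s) = 0" using assms(1,2) b P by (simp add: form_eval_infinity)
  hence "degree g \<le> s" using assms(1) 
    by (metis coeff_0 degree_0 le_SucE leading_coeff_0_iff zero_le)
  thus ?thesis using that[of "Polynomial.smult (1 / b) g"] b P by (simp add: lin_def)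
qed

lemma form_root_exists:
  fixes g :: "'a::alg_closed_field poly"
  assumes "degree g \<le> Suc s"
  obtains P where "P \<noteq> (0, 0)" "form_eval (Suc s) g P = 0"
proof (cases "coeff g (Suc s) = 0")
  case True
  thus ?thesis using that[of "(0, 1)"] assms by (simp add: form_eval_infinity)
next
  case False
  hence "degree g > 0" using le_degree by fastforce
  then obtain z where "poly g z = 0" using alg_closed_imp_poly_has_root by blast
  thus ?thesis using that[of "(1, z)"] assms by (simp add: form_eval_affine)
qed

text \<open>
  The functionals that vanish on all multiples of \<open>lin P\<close> are the multiples of evaluation at \<open>P\<close>.
\<close>

lemma power_seq_proportional:
  assumes "\<And>j. j < d \<Longrightarrow> contract P Z j = 0" "P \<noteq> (0, 0)"
  obtains c where "\<And>j. j \<le> d \<Longrightarrow> Z j = c * power_seq d P j"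
proof (cases "fst P = 0")
  case True
  then obtain b where P: "P = (0, b)" "b \<noteq> 0" using assms(2) by (cases P) auto
  have "Z j = 0" if "j < d" for j using assms(1)[OF that] P by (simp add: contract_def)
  hence "Z j = (Z d / b ^ d) * power_seq d P j" if "j \<le> d" for j
    using that P by (cases "j = d") (auto simp: power_seq_def)
  thus ?thesis using that by blast
next
  case False
  have step: "Z (Suc j) = snd P / fst P * Z j" if "j < d" for j
    using assms(1)[OF that] False by (simp add: contract_def field_simps)
  have "Z j = (Z 0 / fst P ^ d) * power_seq d P j" if "j \<le> d" for j
    using that
  proof (induction j)
    case 0 thus ?case using False by (simp add: power_seq_def)
  next
    case (Suc j)
    have "d - j = Suc (d - Suc j)" using Suc.prems by simp
    thus ?case using step[of j] Suc False by (simp add: power_seq_def field_simps)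
  qed
  thus ?thesis using that by blast
qed

lemma contract_power_seq:
  "j < d \<Longrightarrow> contract P (power_seq d Q) j = (snd P * fst Q - fst P * snd Q) * power_seq (d - 1) Q j"
  by (cases d) (auto simp: contract_def power_seq_def Suc_diff_le algebra_simps)

text \<open>
  Divisibility of forms, of degrees \<open>a\<close> and \<open>s\<close>: the quotient has degree at most \<open>s - a\<close>, which
  for the dehomogenized polynomials is more than divisibility.
\<close>

definition form_dvd :: "nat \<Rightarrow> 'a::field poly \<Rightarrow> nat \<Rightarrow> 'a poly \<Rightarrow> bool" where
  "form_dvd a f s g \<longleftrightarrow> g = 0 \<or> (\<exists>h. degree h + a \<le> s \<and> g = f * h)"

lemma complement_exists:
  fixes P :: "'a::field \<times> 'a"
  assumes "P \<noteq> (0, 0)"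
  obtains m where "form_eval 1 (lin m) P = 1"
proof (cases "fst P = 0")
  case True
  hence "snd P \<noteq> 0" using assms by (cases P) auto
  thus ?thesis using that[of "(-1 / snd P, 0)"] form_eval_lin[of "(-1 / snd P, 0)" P] by simp
next
  case False
  thus ?thesis using that[of "(0, 1 / fst P)"] form_eval_lin[of "(0, 1 / fst P)" P] by simp
qed

text \<open>
  Below the degree \<open>d + 2 - a\<close> the apolar ideal is generated by an annihilator \<open>f\<close> of minimal
  degree \<open>a\<close>. Strip a root \<open>P\<close> from \<open>f = L f'\<close>; then \<open>f'\<close> is minimal for the contraction by \<open>L\<close>,
  and by induction \<open>g = f' h\<close>. Reduce \<open>h\<close> modulo \<open>L\<close> to a multiple \<open>c M^(t+1)\<close> of a power of a
  linear form \<open>M\<close> independent of \<open>L\<close>. If \<open>c\<close> were nonzero, \<open>f' M^(t+1)\<close> would annihilate as \<open>f' L\<close>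
  does; every form of degree \<open>d - a + 1\<close> being a combination of a multiple of \<open>L\<close> and a power of
  \<open>M\<close>, the form \<open>f'\<close> itself would annihilate, against minimality. (In the proof \<open>a\<close> is
  already the degree of \<open>f'\<close>.)
\<close>

theorem minimal_annihilator_dvd:
  fixes Z :: "nat \<Rightarrow> 'a::alg_closed_field"
  assumes "annihilates d Z a f" "f \<noteq> 0"
    and "\<And>m e. m < a \<Longrightarrow> annihilates d Z m e \<Longrightarrow> e = 0"
    and "annihilates d Z s g" "a + s \<le> Suc d"
  shows "form_dvd a f s g"
  using assms
proof (induction a arbitrary: d Z f g)
  case 0
  obtain c where c: "f = [:c:]" using annihilates_degree[OF 0(1)] degree0_coeffs by blast
  have "g = f * Polynomial.smult (1 / c) g" using c 0(2) by simp
  moreover have "degree (Polynomial.smult (1 / c) g) + 0 \<le> s"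
    using annihilates_degree[OF 0(4)] degree_smult_le[of "1 / c" g] by linarith
  ultimately show ?case unfolding form_dvd_def by blast
next
  case (Suc a)
  show ?case
  proof (cases "s \<le> a")
    case True
    thus ?thesis using Suc.prems(3)[of s g] Suc.prems(4) by (simp add: form_dvd_def)
  next
    case False
    then obtain d' where d: "d = Suc d'" using Suc.prems(5) by (cases d) auto
    obtain P where P: "P \<noteq> (0, 0)" "form_eval (Suc a) f P = 0"
      using form_root_exists annihilates_degree[OF Suc.prems(1)] by blast
    obtain f' where f': "degree f' \<le> a" "f = lin P * f'"
      using form_root_factor[OF annihilates_degree[OF Suc.prems(1)] P(2,1)] by blast
    have f'0: "f' \<noteq> 0" using Suc.prems(2) f' by auto
    have ann': "annihilates d' (contract P Z) a f'"
      using annihilates_contract_lin Suc.prems(1) f' d by blast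
    have "form_dvd a f' s g"
    proof (rule Suc.IH[OF ann' f'0])
      fix m e assume "m < a" "annihilates d' (contract P Z) m e"
      hence "lin P * e = 0"
        using Suc.prems(3)[of "Suc m"] annihilates_lin_contract d by blast
      thus "e = 0" using P(1) by simp
    qed (use annihilates_contract[of d' Z s g P] Suc.prems(4,5) d in auto)
    then consider "g = 0" | h where "degree h + a \<le> s" "g = f' * h"
      unfolding form_dvd_def by blast
    thus ?thesis
    proof cases
      case (2 h)
      define t where "t = s - Suc a"
      have s: "s = Suc t + a" using False by (simp add: t_def)
      have hdeg: "degree h \<le> Suc t" using 2(1) s by simp
      obtain m where m: "form_eval 1 (lin m) P = 1" using complement_exists[OF P(1)] by blast
      define c where "c = form_eval (Suc t) h P"
      let ?M = "lin m"
      have Mdeg: "degree (?M ^ n) \<le> n" for n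
        using degree_power_le[of ?M n] degree_lin_le[of m]
        by (metis le_trans mult.commute mult_le_mono1 mult_1)
      have "form_eval (Suc t) (h - Polynomial.smult c (?M ^ Suc t)) P = 0"
        using form_eval_power[OF degree_lin_le, of "Suc t" m P] m
        by (simp add: form_eval_diff form_eval_smult c_def del: power_Suc)
      moreover have "degree (h - Polynomial.smult c (?M ^ Suc t)) \<le> Suc t"
        using hdeg Mdeg[of "Suc t"] degree_smult_le[of c "?M ^ Suc t"]
        by (intro degree_diff_le) linarith+
      ultimately obtain h' where h': "degree h' \<le> t" "h - Polynomial.smult c (?M ^ Suc t) = lin P * h'"
        using form_root_factor P(1) by blast
      have fh': "annihilates d Z s (f * h')"
        using annihilates_mult[OF Suc.prems(1)] h'(1) s by simp
      have "g - f * h' = Polynomial.smult c (f' * ?M ^ Suc t)"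
      proof -
        have "g - f * h' = f' * (h - lin P * h')" using 2(2) f'(2) by (simp add: algebra_simps)
        also have "h - lin P * h' = Polynomial.smult c (?M ^ Suc t)" using h'(2) by (simp add: algebra_simps)
        finally show ?thesis by simp
      qed
      hence rem: "annihilates d Z s (Polynomial.smult c (f' * ?M ^ Suc t))"
        using annihilates_diff[OF Suc.prems(4) fh'] by simp
      \<comment> \<open>A nonzero remainder would make \<open>f'\<close> an annihilator of degree below the minimum.\<close>
      have "c = 0"
      proof (rule ccontr)
        assume "c \<noteq> 0"
        hence rem': "annihilates d Z s (f' * ?M ^ Suc t)"
          using annihilates_smult[OF rem, of "1 / c"] by simp
        define u where "u = d - s"
        have du: "d = s + u" using Suc.prems(5) by (simp add: u_def)
        have "annihilates d Z a f'"
          unfolding annihilates_def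
        proof safe
          show "degree f' \<le> a" by (fact f')
          fix k :: "'a poly" assume "degree k + a \<le> d"
          hence k: "degree k \<le> Suc (t + u)" using du s by simp
          define b where "b = form_eval (Suc (t + u)) k P"
          have "form_eval (Suc (t + u)) (k - Polynomial.smult b (?M ^ Suc (t + u))) P = 0"
            using form_eval_power[OF degree_lin_le, of "Suc (t + u)" m P] m
            by (simp add: form_eval_diff form_eval_smult b_def del: power_Suc)
          moreover have "degree (k - Polynomial.smult b (?M ^ Suc (t + u))) \<le> Suc (t + u)"
            using k Mdeg[of "Suc (t + u)"] degree_smult_le[of b "?M ^ Suc (t + u)"]
            by (intro degree_diff_le) linarith+
          ultimately obtain k' where k': "degree k' \<le> t + u"
              "k - Polynomial.smult b (?M ^ Suc (t + u)) = lin P * k'"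
            using form_root_factor P(1) by blast
          have "f' * k = f * k' + Polynomial.smult b ((f' * ?M ^ Suc t) * ?M ^ u)"
          proof -
            have "k = lin P * k' + Polynomial.smult b (?M ^ Suc (t + u))" using k'(2) by (simp add: algebra_simps)
            thus ?thesis using f'(2) by (simp add: algebra_simps power_add)
          qed
          moreover have "apol Z (f * k') = 0"
            using annihilatesD[OF Suc.prems(1)] k'(1) du s by simp
          moreover have "apol Z ((f' * ?M ^ Suc t) * ?M ^ u) = 0"
            using annihilatesD[OF rem'] Mdeg[of u] du by simp
          ultimately show "apol Z (f' * k) = 0" by (simp add: apol_add apol_smult)
        qed
        thus False using Suc.prems(3)[of a f'] f'0 by simp
      qed
      hence "g = f * h'" using \<open>g - f * h' = _\<close> by simp
      moreover have "degree h' + Suc a \<le> s" using h'(1) s by simp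
      ultimately show ?thesis unfolding form_dvd_def by blast
    qed (simp add: form_dvd_def)
  qed
qed

definition independent_points :: "nat \<Rightarrow> (nat \<Rightarrow> 'a::field \<times> 'a) \<Rightarrow> bool" where
  "independent_points r P \<longleftrightarrow>
     (\<forall>i<r. P i \<noteq> (0, 0)) \<and>
     (\<forall>i<r. \<forall>j<r. i \<noteq> j \<longrightarrow> snd (P i) * fst (P j) \<noteq> fst (P i) * snd (P j))"

lemma degree_prod_lin: "degree (\<Prod>i<r. lin (P i)) \<le> r"
proof (induction r)
  case (Suc r)
  thus ?case using degree_lin_mult[OF Suc, of "P r"] by (simp add: mult.commute)
qed simp

text \<open>
  The apolarity lemma: a squarefree annihilator yields a sum of powers. The contraction by the last
  factor is a sum of powers by induction; rescaling its coefficients by the values of that factor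
  lifts them to a functional that differs from \<open>Z\<close> by one vanishing on the multiples of the factor,
  hence by a multiple of the last evaluation.
\<close>

theorem apolarity:
  fixes Z :: "nat \<Rightarrow> 'a::field"
  assumes "independent_points r P" "annihilates d Z r (\<Prod>i<r. lin (P i))"
  shows "\<exists>c. \<forall>j\<le>d. Z j = (\<Sum>i<r. c i * power_seq d (P i) j)"
  using assms
proof (induction r arbitrary: d Z)
  case 0
  have "Z j = 0" if "j \<le> d" for j
    using annihilatesD[OF 0(2), of "Polynomial.monom 1 j"] that by (simp add: apol_monom degree_monom_eq)
  thus ?case by simp
next
  case (Suc r)
  let ?Q = "P r"
  have Q: "?Q \<noteq> (0, 0)" using Suc.prems(1) by (simp add: independent_points_def)
  have "\<exists>c. \<forall>j<d. contract ?Q Z j = (\<Sum>i<r. c i * power_seq (d - 1) (P i) j)"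
  proof (cases d)
    case (Suc d')
    have ann: "annihilates (Suc d') Z (Suc r) (lin ?Q * (\<Prod>i<r. lin (P i)))"
      using Suc.prems(2) Suc by (simp add: mult.commute)
    have "annihilates d' (contract ?Q Z) r (\<Prod>i<r. lin (P i))"
      by (rule annihilates_contract_lin[OF ann degree_prod_lin])
    moreover have "independent_points r P"
      using Suc.prems(1) by (auto simp: independent_points_def)
    ultimately have "\<exists>c. \<forall>j\<le>d'. contract ?Q Z j = (\<Sum>i<r. c i * power_seq d' (P i) j)"
      using Suc.IH by blast
    thus ?thesis using Suc by (simp add: less_Suc_eq_le)
  qed simp
  then obtain c where c: "\<And>j. j < d \<Longrightarrow> contract ?Q Z j = (\<Sum>i<r. c i * power_seq (d - 1) (P i) j)"
    by blast
  define \<delta> where "\<delta> i = snd ?Q * fst (P i) - fst ?Q * snd (P i)" for i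
  have \<delta>: "\<delta> i \<noteq> 0" if "i < r" for i
    using Suc.prems(1) that unfolding independent_points_def \<delta>_def
    by (metis eq_iff_diff_eq_0 less_SucI lessI nat_neq_iff)
  define Y where "Y j = Z j - (\<Sum>i<r. c i / \<delta> i * power_seq d (P i) j)" for j
  have "contract ?Q Y j = 0" if j: "j < d" for j
  proof -
    have "contract ?Q Y j = contract ?Q Z j
        - (\<Sum>i<r. c i / \<delta> i * contract ?Q (power_seq d (P i)) j)"
      by (simp add: contract_def Y_def algebra_simps sum_distrib_left sum_subtractf)
    also have "(\<Sum>i<r. c i / \<delta> i * contract ?Q (power_seq d (P i)) j)
        = (\<Sum>i<r. c i * power_seq (d - 1) (P i) j)"
      using \<delta> by (intro sum.cong) (auto simp: contract_power_seq[OF j] \<delta>_def[symmetric])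
    finally show ?thesis using c[OF j] by simp
  qed
  then obtain b where b: "\<And>j. j \<le> d \<Longrightarrow> Y j = b * power_seq d ?Q j"
    using power_seq_proportional[of d ?Q Y] Q by blast
  have "Z j = (\<Sum>i<Suc r. (if i = r then b else c i / \<delta> i) * power_seq d (P i) j)" if "j \<le> d" for j
  proof -
    have "Z j = (\<Sum>i<r. c i / \<delta> i * power_seq d (P i) j) + b * power_seq d ?Q j"
      using b[OF that] by (simp add: Y_def algebra_simps)
    thus ?thesis by simp
  qed
  thus ?case by (intro exI[of _ "\<lambda>i. if i = r then b else c i / \<delta> i"]) simp
qed

section \<open>Linear systems and the rank of a matrix\<close>

text \<open>
  Padding the coefficient matrix with zero rows makes it square and singular.
\<close>

lemma underdetermined_system:
  fixes A :: "nat \<Rightarrow> nat \<Rightarrow> 'a::field"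
  assumes "m < n"
  obtains x where "\<exists>j<n. x j \<noteq> 0" "\<And>i. i < m \<Longrightarrow> (\<Sum>j<n. A i j * x j) = 0"
proof -
  define B where "B = mat n n (\<lambda>(i, j). if i < m then A i j else 0)"
  have B: "B \<in> carrier_mat n n" by (simp add: B_def)
  have "row B m = 0\<^sub>v n" using assms by (intro eq_vecI) (auto simp: B_def)
  hence "B = mat\<^sub>r n n (\<lambda>i. if i = m then 0\<^sub>v n else row B i)"
    using B assms by (intro eq_matI) (auto simp: mat_of_rows_def B_def)
  hence "det B = 0" using det_row_0[OF assms, of "\<lambda>i. row B i"] B by auto
  then obtain v where v: "v \<in> carrier_vec n" "v \<noteq> 0\<^sub>v n" "B *\<^sub>v v = 0\<^sub>v n"
    using det_0_iff_vec_prod_zero_field[OF B] by blast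
  have "\<exists>j<n. v $ j \<noteq> 0" using v(1,2) by (metis carrier_vecD eq_vecI index_zero_vec)
  moreover have "(\<Sum>j<n. A i j * v $ j) = 0" if "i < m" for i
  proof -
    have "(B *\<^sub>v v) $ i = (\<Sum>j<n. A i j * v $ j)"
      using that assms v(1) B by (simp add: B_def scalar_prod_def atLeast0LessThan)
    thus ?thesis using v(3) that assms by simp
  qed
  ultimately show ?thesis using that[of "\<lambda>j. v $ j"] by blast
qed

lemma underdetermined_poly:
  fixes A :: "nat \<Rightarrow> nat \<Rightarrow> 'a::field"
  assumes "m \<le> s"
  obtains g where "g \<noteq> 0" "degree g \<le> s" "\<And>i. i < m \<Longrightarrow> apol (A i) g = 0"
proof -
  obtain x where x: "\<exists>j<Suc s. x j \<noteq> 0" "\<And>i. i < m \<Longrightarrow> (\<Sum>j<Suc s. A i j * x j) = 0"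
    using underdetermined_system[of m "Suc s" A] assms by auto
  define g where "g = (\<Sum>j\<le>s. Polynomial.monom (x j) j)"
  have coeff: "coeff g j = (if j \<le> s then x j else 0)" for j
    unfolding g_def coeff_sum by (simp add: if_distrib cong: if_cong)
  have deg: "degree g \<le> s" by (rule degree_le) (simp add: coeff)
  have "g \<noteq> 0" using x(1) coeff by (metis coeff_0 less_Suc_eq_le)
  moreover have "apol (A i) g = 0" if "i < m" for i
    unfolding apol_bound[OF deg] using x(2)[OF that] coeff
    by (simp add: lessThan_Suc_atMost mult.commute)
  ultimately show ?thesis using deg that by blast
qed

text \<open>
  It suffices to test against monomials, and these tests are the rows of a Hankel matrix.
\<close>

lemma annihilates_iff_rows:
  assumes "s \<le> d" "degree g \<le> s"
  shows "annihilates d Z s g \<longleftrightarrow> (\<forall>i\<le>d - s. apol (\<lambda>j. Z (i + j)) g = 0)"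
proof -
  have shift: "apol Z (g * Polynomial.monom 1 i) = apol (\<lambda>j. Z (i + j)) g" for i and Z :: "nat \<Rightarrow> 'a"
  proof (induction i arbitrary: Z)
    case (Suc i)
    have "g * Polynomial.monom 1 (Suc i) = pCons 0 (g * Polynomial.monom 1 i)"
      by (simp add: monom_Suc)
    thus ?case using Suc.IH[of "\<lambda>j. Z (Suc j)"] by (simp add: apol_pCons)
  qed simp
  show ?thesis
  proof safe
    fix i assume "annihilates d Z s g" "i \<le> d - s"
    thus "apol (\<lambda>j. Z (i + j)) g = 0"
      using annihilatesD[of d Z s g "Polynomial.monom 1 i"] assms(1) shift[of Z i]
      by (simp add: degree_monom_eq)
  next
    assume rows: "\<forall>i\<le>d - s. apol (\<lambda>j. Z (i + j)) g = 0"
    show "annihilates d Z s g"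
      unfolding annihilates_def
    proof safe
      fix h :: "'a poly" assume h: "degree h + s \<le> d"
      have "g * h = g * (\<Sum>i\<le>degree h. Polynomial.monom (coeff h i) i)"
        by (simp add: poly_as_sum_of_monoms)
      also have "\<dots> = (\<Sum>i\<le>degree h. Polynomial.smult (coeff h i) (g * Polynomial.monom 1 i))"
        by (simp add: sum_distrib_left smult_monom flip: mult_smult_right)
      finally have "apol Z (g * h) = (\<Sum>i\<le>degree h. coeff h i * apol (\<lambda>j. Z (i + j)) g)"
        by (simp only: apol_sum apol_smult shift)
      thus "apol Z (g * h) = 0" using rows h by (auto intro!: sum.neutral)
    qed (fact assms(2))
  qed
qed

lemma short_annihilator_exists:
  assumes "d < 2 * s"
  obtains g where "g \<noteq> 0" "annihilates d Z s g"
proof (cases "s \<le> d")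
  case True
  obtain g where g: "g \<noteq> 0" "degree g \<le> s" "\<And>i. i < Suc (d - s) \<Longrightarrow> apol (\<lambda>j. Z (i + j)) g = 0"
    using underdetermined_poly[of "Suc (d - s)" s "\<lambda>i j. Z (i + j)"] assms True by (metis Suc_leI less_diff_conv2 mult_2)
  hence "annihilates d Z s g"
    using annihilates_iff_rows[OF True g(2)] by (simp add: less_Suc_eq_le)
  thus ?thesis using g(1) that by blast
next
  case False
  thus ?thesis using that[of 1] by (simp add: annihilates_def)
qed

text \<open>
  A coefficient of a product is a linear condition on one factor, which lets
  \<open>underdetermined_poly\<close> prescribe vanishing coefficients of multiples of \<open>f\<close>.
\<close>

lemma coeff_as_apol: "coeff (f * g) i = apol (\<lambda>j. if j \<le> i then coeff f (i - j) else 0) g"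
proof -
  have "coeff (f * g) i = (\<Sum>j\<le>i. coeff g j * coeff f (i - j))"
    by (subst mult.commute) (simp add: coeff_mult)
  also have "\<dots> = (\<Sum>j\<le>max i (degree g). coeff g j * (if j \<le> i then coeff f (i - j) else 0))"
    by (intro sum.mono_neutral_cong_left) auto
  also have "\<dots> = apol (\<lambda>j. if j \<le> i then coeff f (i - j) else 0) g"
    by (rule apol_bound[symmetric]) simp
  finally show ?thesis .
qed

text \<open>
  A rank criterion in terms of kernel vectors alone: columns \<open>J\<close> with no kernel vector
  supported on them are independent, and a kernel vector supported on \<open>J\<close> and one further column
  expresses that column by those in \<open>J\<close>.
\<close>

lemma (in vec_space) rank_eq_card_pivots:
  assumes A: "A \<in> carrier_mat n nc" and J: "J \<subseteq> {..<nc}"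
    and indep: "\<And>v. v \<in> carrier_vec nc \<Longrightarrow> (\<forall>i<nc. i \<notin> J \<longrightarrow> v $ i = 0) \<Longrightarrow> A *\<^sub>v v = 0\<^sub>v n \<Longrightarrow> v = 0\<^sub>v nc"
    and dep: "\<And>j. j < nc \<Longrightarrow> j \<notin> J \<Longrightarrow> \<exists>v\<in>carrier_vec nc. v $ j \<noteq> 0 \<and> (\<forall>i<nc. i \<notin> insert j J \<longrightarrow> v $ i = 0) \<and> A *\<^sub>v v = 0\<^sub>v n"
  shows "rank A = card J"
proof -
  let ?c = "col A"
  have colc: "?c j \<in> carrier_vec n" for j using A by auto
  have fin: "finite J" using J finite_subset by blast
  have mv: "(A *\<^sub>v v) $ r = (\<Sum>j\<in>K. v $ j * ?c j $ r)"
    if "v \<in> carrier_vec nc" "r < n" "K \<subseteq> {..<nc}" "\<forall>i<nc. i \<notin> K \<longrightarrow> v $ i = 0" for v r K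
  proof -
    have "(A *\<^sub>v v) $ r = (\<Sum>j<nc. v $ j * ?c j $ r)"
      using that A by (auto simp: scalar_prod_def atLeast0LessThan mult.commute intro!: sum.cong)
    also have "\<dots> = (\<Sum>j\<in>K. v $ j * ?c j $ r)"
      using that by (intro sum.mono_neutral_right) auto
    finally show ?thesis .
  qed
  have inj: "inj_on ?c J"
  proof (rule inj_onI, rule ccontr)
    fix i j assume ij: "i \<in> J" "j \<in> J" "?c i = ?c j" "i \<noteq> j"
    define v where "v = vec nc (\<lambda>l. if l = i then 1 else if l = j then - 1 else (0::'a))"
    have v: "v \<in> carrier_vec nc" by (simp add: v_def)
    have "A *\<^sub>v v = 0\<^sub>v n"
    proof (rule eq_vecI)
      fix r assume "r < dim_vec (0\<^sub>v n)"
      hence r: "r < n" by simp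
      have "(A *\<^sub>v v) $ r = (\<Sum>l\<in>{i, j}. v $ l * ?c l $ r)"
        using ij J r by (intro mv[OF v]) (auto simp: v_def)
      also have "\<dots> = 0" using ij J by (simp add: v_def subset_iff)
      finally show "(A *\<^sub>v v) $ r = 0\<^sub>v n $ r" using r by simp
    qed (use A in auto)
    moreover have "\<forall>l<nc. l \<notin> J \<longrightarrow> v $ l = 0" using ij by (auto simp: v_def)
    ultimately have "v = 0\<^sub>v nc" using indep[OF v] by blast
    moreover have "v $ i = 1" using ij J by (auto simp: v_def)
    ultimately show False using ij J by auto
  qed
  let ?U = "?c ` J"
  have Uc: "?U \<subseteq> carrier_vec n" using colc by blast
  have Usub: "?U \<subseteq> set (cols A)" using J A by (auto simp: cols_def)
  have li: "lin_indpt ?U"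
  proof
    assume "lin_dep ?U"
    then obtain a w where aw: "lincomb a ?U = 0\<^sub>v n" "w \<in> ?U" "a w \<noteq> 0"
      using finite_lin_dep[of ?U] fin Uc by auto
    define v where "v = vec nc (\<lambda>l. if l \<in> J then a (?c l) else 0)"
    have v: "v \<in> carrier_vec nc" by (simp add: v_def)
    have "A *\<^sub>v v = 0\<^sub>v n"
    proof (rule eq_vecI)
      fix r assume "r < dim_vec (0\<^sub>v n)"
      hence r: "r < n" by simp
      have "(A *\<^sub>v v) $ r = (\<Sum>l\<in>J. v $ l * ?c l $ r)"
        using J r by (intro mv[OF v]) (auto simp: v_def)
      also have "\<dots> = (\<Sum>l\<in>J. a (?c l) * ?c l $ r)"
        using J by (intro sum.cong) (auto simp: v_def)
      also have "\<dots> = (\<Sum>u\<in>?U. a u * u $ r)" using inj by (simp add: sum.reindex)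
      also have "\<dots> = lincomb a ?U $ r" using lincomb_index[OF r Uc] by simp
      finally show "(A *\<^sub>v v) $ r = 0\<^sub>v n $ r" using aw by simp
    qed (use A in auto)
    moreover have "\<forall>l<nc. l \<notin> J \<longrightarrow> v $ l = 0" by (auto simp: v_def)
    ultimately have v0: "v = 0\<^sub>v nc" using indep[OF v] by blast
    obtain l where l: "l \<in> J" "w = ?c l" using aw by blast
    hence "v $ l = a w" "l < nc" using J by (auto simp: v_def)
    thus False using v0 aw by simp
  qed
  have max: "maximal ?U (\<lambda>T. T \<subseteq> set (cols A) \<and> lin_indpt T)"
    unfolding maximal_def
  proof (intro conjI allI impI)
    show "?U \<subseteq> set (cols A)" "lin_indpt ?U" by (fact Usub, fact li)
    fix T assume "?U \<subseteq> T \<and> T \<subseteq> set (cols A) \<and> lin_indpt T"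
    hence T: "?U \<subseteq> T" "T \<subseteq> set (cols A)" "lin_indpt T" by auto
    show "T = ?U"
    proof (rule ccontr)
      assume "T \<noteq> ?U"
      then obtain w where w: "w \<in> T" "w \<notin> ?U" using T by blast
      then obtain j where j: "j < nc" "w = ?c j" using T(2) A by (auto simp: cols_def)
      hence jJ: "j \<notin> J" using w by blast
      obtain v where v: "v \<in> carrier_vec nc" "v $ j \<noteq> 0" "\<forall>i<nc. i \<notin> insert j J \<longrightarrow> v $ i = 0" "A *\<^sub>v v = 0\<^sub>v n"
        using dep[OF j(1) jJ] by blast
      let ?I = "insert j J"
      have injI: "inj_on ?c ?I" using inj jJ w(2) j(2) by auto
      define a where "a u = v $ (the_inv_into ?I ?c u)" for u
      have ac: "a (?c l) = v $ l" if "l \<in> ?I" for l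
        using the_inv_into_f_f[OF injI that] by (simp add: a_def)
      have Ic: "?c ` ?I \<subseteq> carrier_vec n" using colc by blast
      have "lincomb a (?c ` ?I) = 0\<^sub>v n"
      proof (rule eq_vecI)
        fix r assume "r < dim_vec (0\<^sub>v n)"
        hence r: "r < n" by simp
        have "lincomb a (?c ` ?I) $ r = (\<Sum>u\<in>?c ` ?I. a u * u $ r)"
          using lincomb_index[OF r Ic] by simp
        also have "\<dots> = (\<Sum>l\<in>?I. a (?c l) * ?c l $ r)"
          by (subst sum.reindex[OF injI]) simp
        also have "\<dots> = (\<Sum>l\<in>?I. v $ l * ?c l $ r)" by (intro sum.cong) (simp_all add: ac)
        also have "\<dots> = (A *\<^sub>v v) $ r"
          using J j r v by (intro mv[symmetric]) auto
        finally show "lincomb a (?c ` ?I) $ r = 0\<^sub>v n $ r" using v by simp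
      next
        show "dim_vec (lincomb a (?c ` ?I)) = dim_vec (0\<^sub>v n)"
          using lincomb_dim[OF _ Ic, of a] fin by simp
      qed
      moreover have "a w \<noteq> 0" using ac[of j] j v by simp
      ultimately have "lin_dep (?c ` ?I)"
        using lin_dep_crit[where A="?c ` ?I" and S="?c ` ?I" and a=a and v=w] fin Ic j by auto
      moreover have "?c ` ?I \<subseteq> T" using T w j by auto
      ultimately show False using T(3) subset_li_is_li by blast
    qed
  qed
  show ?thesis using rank_card_indpt[OF A max] inj by (simp add: card_image)
qed

section \<open>Annihilators of minimal degree\<close>

definition minimal_annihilator :: "nat \<Rightarrow> (nat \<Rightarrow> 'a::field) \<Rightarrow> nat \<Rightarrow> 'a poly \<Rightarrow> bool" where
  "minimal_annihilator d Z a f \<longleftrightarrow> annihilates d Z a f \<and> f \<noteq> 0 \<and>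
     (\<forall>m<a. \<forall>e. annihilates d Z m e \<longrightarrow> e = 0)"

lemma minimal_annihilator_form_dvd:
  fixes Z :: "nat \<Rightarrow> 'a::alg_closed_field"
  assumes "minimal_annihilator d Z a f" "annihilates d Z s g" "a + s \<le> Suc d"
  shows "form_dvd a f s g"
  using assms minimal_annihilator_dvd[of d Z a f s g] by (auto simp: minimal_annihilator_def)

text \<open>
  The bound on \<open>a\<close> holds because a Hankel matrix with more columns than rows has a kernel.
\<close>

lemma minimal_annihilator_exists:
  fixes Z :: "nat \<Rightarrow> 'a::field"
  assumes "j \<le> d" "Z j \<noteq> 0"
  obtains a f where "minimal_annihilator d Z a f" "1 \<le> a" "2 * a \<le> d + 2"
proof -
  define s where "s = d div 2 + 1"
  have "d < 2 * s" unfolding s_def by presburger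
  then obtain g where g: "g \<noteq> 0" "annihilates d Z s g"
    using short_annihilator_exists by blast
  define Q where "Q m \<longleftrightarrow> (\<exists>e. e \<noteq> 0 \<and> annihilates d Z m e)" for m
  define a where "a = (LEAST m. Q m)"
  have "Q s" using g by (auto simp: Q_def)
  hence "Q a" "a \<le> s" unfolding a_def by (auto intro: LeastI Least_le)
  then obtain f where f: "f \<noteq> 0" "annihilates d Z a f" by (auto simp: Q_def)
  have "e = 0" if "m < a" "annihilates d Z m e" for m e
    using not_less_Least[of m Q] that by (auto simp: Q_def a_def)
  hence "minimal_annihilator d Z a f" using f by (auto simp: minimal_annihilator_def)
  moreover have "a \<noteq> 0"
  proof
    assume "a = 0"
    hence "apol Z (Polynomial.monom 1 j) = 0"
      using annihilates_degree_0[of d Z f] f assms(1) by (auto simp: degree_monom_eq)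
    thus False using assms(2) by (simp add: apol_monom)
  qed
  moreover have "2 * a \<le> d + 2" using \<open>a \<le> s\<close> by (simp add: s_def)
  ultimately show ?thesis using that by auto
qed

definition poly_of_coeffs :: "'a::zero vec \<Rightarrow> 'a poly" where
  "poly_of_coeffs v = Poly (list_of_vec v)"

lemma coeff_poly_of_coeffs: "coeff (poly_of_coeffs v) j = (if j < dim_vec v then v $ j else 0)"
  by (simp add: poly_of_coeffs_def coeff_Poly_eq nth_default_def list_of_vec_index)

lemma degree_poly_of_coeffs: "v \<in> carrier_vec (Suc s) \<Longrightarrow> degree (poly_of_coeffs v) \<le> s"
  by (intro degree_le) (auto simp: coeff_poly_of_coeffs)

lemma poly_of_coeffs_vec:
  "degree g \<le> s \<Longrightarrow> poly_of_coeffs (vec (Suc s) (coeff g)) = g"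
  by (intro poly_eqI) (auto simp: coeff_poly_of_coeffs coeff_eq_0)

lemma poly_of_coeffs_eq_0_iff:
  "v \<in> carrier_vec n \<Longrightarrow> poly_of_coeffs v = 0 \<longleftrightarrow> v = 0\<^sub>v n"
  by (auto simp: poly_eq_iff coeff_poly_of_coeffs intro!: eq_vecI)

lemma hankel_kernel:
  fixes Z :: "nat \<Rightarrow> 'a::field"
  assumes "s \<le> d" "v \<in> carrier_vec (Suc s)"
  shows "hankel_mat Z (Suc (d - s)) (Suc s) *\<^sub>v v = 0\<^sub>v (Suc (d - s)) \<longleftrightarrow>
    annihilates d Z s (poly_of_coeffs v)"
proof -
  let ?H = "hankel_mat Z (Suc (d - s)) (Suc s)"
  have deg: "degree (poly_of_coeffs v) \<le> s" using degree_poly_of_coeffs assms(2) .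
  have row: "(?H *\<^sub>v v) $ i = apol (\<lambda>j. Z (i + j)) (poly_of_coeffs v)" if "i < Suc (d - s)" for i
    unfolding apol_bound[OF deg] using that assms(2)
    by (auto simp: hankel_mat_def scalar_prod_def coeff_poly_of_coeffs atLeast0LessThan
        lessThan_Suc_atMost mult.commute intro!: sum.cong)
  have "?H *\<^sub>v v = 0\<^sub>v (Suc (d - s)) \<longleftrightarrow> (\<forall>i<Suc (d - s). (?H *\<^sub>v v) $ i = 0)"
    by (subst vec_eq_iff) (simp add: hankel_mat_def)
  also have "\<dots> \<longleftrightarrow> (\<forall>i\<le>d - s. apol (\<lambda>j. Z (i + j)) (poly_of_coeffs v) = 0)"
    using row by (simp add: less_Suc_eq_le)
  finally show ?thesis using annihilates_iff_rows[OF assms(1) deg, of Z] by simp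
qed

text \<open>
  The kernel consists of the multiples \<open>f h\<close> with \<open>h\<close> of degree at most \<open>s - a\<close>. With \<open>p = degree f\<close>,
  their leading coefficients sit in the window of \<open>s + 1 - a\<close> columns starting at \<open>p\<close>, and each of
  these positions occurs; the \<open>a\<close> columns outside the window are therefore pivots. When \<open>f\<close> has
  roots at infinity, \<open>p < a\<close> and the pivots are not an initial segment.
\<close>

lemma rank_hankel:
  fixes Z :: "nat \<Rightarrow> 'a::alg_closed_field"
  assumes min: "minimal_annihilator d Z a f" and s: "s \<le> d" "a \<le> Suc s" "a + s \<le> Suc d"
  shows "mat_rank (hankel_mat Z (Suc (d - s)) (Suc s)) = a"
proof -
  let ?H = "hankel_mat Z (Suc (d - s)) (Suc s)"
  define p where "p = degree f"
  have f: "f \<noteq> 0" "annihilates d Z a f" using min by (auto simp: minimal_annihilator_def)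
  have p: "p \<le> a" using annihilates_degree[OF f(2)] by (simp add: p_def)
  define I where "I = {p..<p + (Suc s - a)}"
  have I: "I \<subseteq> {..<Suc s}" using p s by (auto simp: I_def)
  define J where "J = {..<Suc s} - I"
  have "card J = a" using I s by (simp add: J_def card_Diff_subset I_def)
  moreover have "vec_space.rank (Suc (d - s)) ?H = card J"
  proof (rule vec_space.rank_eq_card_pivots[where nc = "Suc s"])
    show "?H \<in> carrier_mat (Suc (d - s)) (Suc s)" by (simp add: hankel_mat_def)
    show "J \<subseteq> {..<Suc s}" by (auto simp: J_def)
  next
    fix v :: "'a vec"
    assume v: "v \<in> carrier_vec (Suc s)" "\<forall>i<Suc s. i \<notin> J \<longrightarrow> v $ i = 0"
      "?H *\<^sub>v v = 0\<^sub>v (Suc (d - s))"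
    let ?g = "poly_of_coeffs v"
    have "annihilates d Z s ?g" using hankel_kernel[OF s(1) v(1)] v(3) by blast
    hence "form_dvd a f s ?g" using minimal_annihilator_form_dvd min s(3) by blast
    hence "?g = 0"
      unfolding form_dvd_def
    proof (elim disjE exE conjE)
      fix h assume h: "degree h + a \<le> s" "?g = f * h"
      have I': "p + degree h \<in> I" "p + degree h < Suc s" using h p by (auto simp: I_def)
      hence "p + degree h \<notin> J" by (simp add: J_def)
      hence "coeff ?g (p + degree h) = 0" using v(1,2) I' by (auto simp: coeff_poly_of_coeffs)
      hence "h = 0" using f(1) coeff_mult_degree_sum[of f h] h(2) by (simp add: p_def)
      thus ?thesis using h by simp
    qed
    thus "v = 0\<^sub>v (Suc s)" using poly_of_coeffs_eq_0_iff[OF v(1)] by blast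
  next
    fix j assume "j < Suc s" "j \<notin> J"
    hence "j \<in> I" by (auto simp: J_def)
    then obtain e where e: "j = p + e" "e < Suc s - a" by (auto simp: I_def le_iff_add)
    obtain h where h: "h \<noteq> 0" "degree h \<le> e"
      "\<And>i. i < e \<Longrightarrow> apol (\<lambda>l. if l \<le> p + i then coeff f (p + i - l) else 0) h = 0"
      using underdetermined_poly[of e e "\<lambda>i l. if l \<le> p + i then coeff f (p + i - l) else 0"] by auto
    have low: "coeff (f * h) (p + i) = 0" if "i < e" for i
      using h(3)[OF that] coeff_as_apol[of f h "p + i"] by simp
    have top: "coeff (f * h) (p + degree h) \<noteq> 0"
      using coeff_mult_degree_sum[of f h] f(1) h(1) by (simp add: p_def)
    have he: "degree h = e" using low[of "degree h"] top h(2) by (meson le_neq_implies_less)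
    have fh: "annihilates d Z s (f * h)" using annihilates_mult[OF f(2)] he e(2) by simp
    let ?v = "vec (Suc s) (coeff (f * h))"
    have "?H *\<^sub>v ?v = 0\<^sub>v (Suc (d - s))"
      using hankel_kernel[OF s(1), of ?v Z] fh
      by (simp add: poly_of_coeffs_vec[OF annihilates_degree[OF fh]])
    moreover have "?v $ j \<noteq> 0" using top he e \<open>j < Suc s\<close> by simp
    moreover have "?v $ i = 0" if "i < Suc s" "i \<notin> insert j J" for i
    proof -
      have iI: "i \<in> I" "i \<noteq> j" using that by (auto simp: J_def)
      then obtain e' where e': "i = p + e'" by (auto simp: I_def le_iff_add)
      have "coeff (f * h) i = 0"
      proof (cases "e' < e")
        case True thus ?thesis using low e' by simp
      next
        case False
        hence "degree (f * h) < i" using iI e' e he degree_mult_le[of f h] p_def by linarith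
        thus ?thesis by (rule coeff_eq_0)
      qed
      thus ?thesis using that by simp
    qed
    ultimately show "\<exists>v\<in>carrier_vec (Suc s). v $ j \<noteq> 0 \<and>
        (\<forall>i<Suc s. i \<notin> insert j J \<longrightarrow> v $ i = 0) \<and> ?H *\<^sub>v v = 0\<^sub>v (Suc (d - s))"
      by (intro bexI[of _ ?v]) auto
  qed
  ultimately show ?thesis by (simp add: mat_rank_def hankel_mat_def)
qed

text \<open>
  The apolar ideal is a complete intersection: in degree \<open>d + 2 - a\<close> there is a second generator
  coprime to \<open>f\<close>. Counting conditions gives an annihilator \<open>g\<close> that is no multiple of \<open>f\<close>. A
  common root of \<open>f\<close> and \<open>g\<close> could be stripped from both; after contraction the cofactor of \<open>f\<close> is
  minimal and the degrees are low enough for it to divide that of \<open>g\<close>, so \<open>f\<close> would divide \<open>g\<close>.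
\<close>

lemma coprime_annihilator_exists:
  fixes Z :: "nat \<Rightarrow> 'a::alg_closed_field"
  assumes min: "minimal_annihilator d Z a f" and a: "1 \<le> a" "2 * a \<le> d + 2" and d: "1 \<le> d"
  obtains g where "g \<noteq> 0" "annihilates d Z (d + 2 - a) g"
    "\<And>P. P \<noteq> (0, 0) \<Longrightarrow> form_eval a f P = 0 \<Longrightarrow> form_eval (d + 2 - a) g P \<noteq> 0"
proof -
  define s where "s = d + 2 - a"
  have f: "f \<noteq> 0" "annihilates d Z a f" using min by (auto simp: minimal_annihilator_def)
  have as: "a \<le> s" using a by (simp add: s_def)
  \<comment> \<open>There are \<open>a - 1\<close> Hankel rows, and \<open>s - a + 1\<close> coefficients set to zero: the positions at which the
    leading term of a multiple of \<open>f\<close> of degree \<open>s\<close> can occur. The latter exclude multiples of \<open>f\<close>.\<close>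
  let ?A = "\<lambda>i. if i < a - 1 then (\<lambda>j. Z (i + j))
     else (\<lambda>j. if j = degree f + (i - (a - 1)) then 1 else 0)"
  obtain g where g: "g \<noteq> 0" "degree g \<le> s" "\<And>i. i < s \<Longrightarrow> apol (?A i) g = 0"
    using underdetermined_poly[of s s ?A] by auto
  have ann: "annihilates d Z s g"
  proof (cases "s \<le> d")
    case True
    have "apol (\<lambda>j. Z (i + j)) g = 0" if "i \<le> d - s" for i
    proof -
      have "i < a - 1" "i < s" using that as a True by (auto simp: s_def)
      thus ?thesis using g(3)[of i] by simp
    qed
    thus ?thesis using annihilates_iff_rows[OF True g(2)] by blast
  qed (use g(2) in \<open>auto simp: annihilates_def\<close>)
  have notdvd: "\<not> form_dvd a f s g"
  proof
    assume "form_dvd a f s g"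
    then obtain h where h: "degree h + a \<le> s" "g = f * h" using g(1) by (auto simp: form_dvd_def)
    let ?i = "a - 1 + degree h"
    have "?i < s" using h(1) a by simp
    hence "apol (\<lambda>j. if j = degree f + degree h then 1 else 0) g = 0" using g(3)[of ?i] by simp
    moreover have "apol (\<lambda>j. if j = degree f + degree h then 1 else 0) g = coeff g (degree f + degree h)"
      using h g(1) by (simp add: apol_def degree_mult_eq if_distrib cong: if_cong)
    ultimately have "g = 0" using coeff_mult_degree_sum[of f h] h f(1) by auto
    thus False using g(1) by simp
  qed
  show ?thesis
  proof (rule that[OF g(1)])
    show "annihilates d Z (d + 2 - a) g" using ann by (simp add: s_def)
    fix P :: "'a \<times> 'a" assume P: "P \<noteq> (0, 0)" "form_eval a f P = 0"
    show "form_eval (d + 2 - a) g P \<noteq> 0"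
    proof
      assume g0: "form_eval (d + 2 - a) g P = 0"
      obtain a' s' d' where suc: "a = Suc a'" "s = Suc s'" "d = Suc d'"
        using a as d by (metis Suc_le_D le_trans One_nat_def)
      obtain f' where f': "degree f' \<le> a'" "f = lin P * f'"
        using form_root_factor[of f a' P] annihilates_degree[OF f(2)] P suc by blast
      obtain g' where g': "degree g' \<le> s'" "g = lin P * g'"
        using form_root_factor[of g s' P] g(2) P(1) g0 suc s_def by metis
      have "minimal_annihilator d' (contract P Z) a' f'"
        unfolding minimal_annihilator_def
      proof (intro conjI allI impI)
        show "annihilates d' (contract P Z) a' f'"
          using annihilates_contract_lin f f' suc by blast
        show "f' \<noteq> 0" using f f' by auto
        fix m e assume "m < a'" "annihilates d' (contract P Z) m e"
        hence "annihilates d Z (Suc m) (lin P * e)" "Suc m < a"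
          using annihilates_lin_contract[of d' P Z m e] suc by auto
        hence "lin P * e = 0" using min unfolding minimal_annihilator_def by blast
        thus "e = 0" using P(1) by simp
      qed
      moreover have "annihilates d' (contract P Z) s' g'"
        using annihilates_contract_lin ann g' suc by blast
      moreover have "a' + s' \<le> Suc d'" using suc s_def by simp
      ultimately have "form_dvd a' f' s' g'" by (rule minimal_annihilator_form_dvd)
      hence "form_dvd a f s g" unfolding form_dvd_def
        using f' g' suc by (auto simp: mult.assoc)
      thus False using notdvd by simp
    qed
  qed
qed

section \<open>Squarefree forms and coprime pencils\<close>

definition form_squarefree :: "nat \<Rightarrow> 'a::field poly \<Rightarrow> bool" where
  "form_squarefree s g \<longleftrightarrow> \<not> (\<exists>P h. P \<noteq> (0, 0) \<and> degree h + 2 \<le> s \<and> g = lin P ^ 2 * h)"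

text \<open>
  At a root of \<open>A\<close> the left side vanishes to order one less than \<open>A\<close> does, the right side to at
  least the order of \<open>A\<close>.
\<close>

lemma wronskian_eq_0:
  fixes A B :: "'a::{alg_closed_field, field_char_0} poly"
  assumes eq: "pderiv A * B = A * pderiv B"
    and noroot: "\<And>z. poly A z = 0 \<Longrightarrow> poly B z \<noteq> 0"
  shows "degree A = 0"
proof (rule ccontr)
  assume deg: "degree A \<noteq> 0"
  then obtain z where z: "poly A z = 0" using alg_closed_imp_poly_has_root by blast
  have A: "A \<noteq> 0" "pderiv A \<noteq> 0" using deg by (auto simp: pderiv_eq_0_iff)
  have Bz: "poly B z \<noteq> 0" using noroot z .
  hence B: "B \<noteq> 0" "Polynomial.order z B = 0" by (auto simp: order_root)
  have nz: "pderiv A * B \<noteq> 0" "A * pderiv B \<noteq> 0" using A B eq by auto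
  have "Polynomial.order z A = Suc (Polynomial.order z (pderiv A))"
    using A(1) z by (rule order_pderiv)
  moreover have "Polynomial.order z (pderiv A) = Polynomial.order z A + Polynomial.order z (pderiv B)"
    using eq order_mult[OF nz(1), of z] order_mult[OF nz(2), of z] B by simp
  ultimately show False by simp
qed

text \<open>
  Bertini for a pencil of coprime binary forms. A double root of \<open>A + c B\<close> is a root of the
  Wronskian, at which \<open>B\<close> is nonzero and \<open>c = - A / B\<close>; so only finitely many \<open>c\<close> are bad. One more
  value of \<open>c\<close> is excluded to keep the point at infinity from being a root.
\<close>

lemma pencil_squarefree:
  fixes A B :: "'a::{alg_closed_field, field_char_0} poly"
  assumes deg: "degree A \<le> s" "degree B \<le> s" and s: "1 \<le> s"
    and coprime: "\<And>P. P \<noteq> (0, 0) \<Longrightarrow> form_eval s A P = 0 \<Longrightarrow> form_eval s B P \<noteq> 0"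
  obtains c where "A + Polynomial.smult c B \<noteq> 0" "form_squarefree s (A + Polynomial.smult c B)"
proof -
  have noroot: "poly B z \<noteq> 0" if "poly A z = 0" for z
    using coprime[of "(1, z)"] deg that by (simp add: form_eval_affine)
  have top: "coeff B s \<noteq> 0" if "coeff A s = 0"
    using coprime[of "(0, 1)"] deg that by (simp add: form_eval_infinity)
  define W where "W = pderiv A * B - A * pderiv B"
  have "W \<noteq> 0"
  proof
    assume "W = 0"
    hence eq: "pderiv A * B = A * pderiv B" by (simp add: W_def)
    have "degree A = 0" using eq noroot by (rule wronskian_eq_0)
    moreover have "degree B = 0"
      by (rule wronskian_eq_0[of B A]) (use eq noroot in \<open>auto simp: mult.commute\<close>)
    ultimately have "coeff A s = 0" "coeff B s = 0" using s by (auto intro!: coeff_eq_0)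
    thus False using top by simp
  qed
  \<comment> \<open>The first value makes infinity a root. If \<open>coeff B s = 0\<close>, it is the default value 0 of the
    quotient; then \<open>coeff A s\<close> is nonzero and infinity is no root for any \<open>c\<close>.\<close>
  define bad where "bad = insert (- coeff A s / coeff B s) ((\<lambda>z. - poly A z / poly B z) ` {z. poly W z = 0})"
  have "finite bad" using poly_roots_finite[OF \<open>W \<noteq> 0\<close>] by (simp add: bad_def)
  then obtain c where c: "c \<notin> bad" using ex_new_if_finite infinite_UNIV_char_0 by blast
  define G where "G = A + Polynomial.smult c B"
  have Gs: "coeff G s \<noteq> 0"
  proof
    assume G0: "coeff G s = 0"
    show False
    proof (cases "coeff B s = 0")
      case True
      thus False using top G0 by (auto simp: G_def)
    next
      case False
      hence "c = - coeff A s / coeff B s" using G0 by (simp add: G_def field_simps eq_neg_iff_add_eq_0)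
      thus False using c by (simp add: bad_def)
    qed
  qed
  have "form_squarefree s G"
    unfolding form_squarefree_def
  proof
    assume "\<exists>P h. P \<noteq> (0, 0) \<and> degree h + 2 \<le> s \<and> G = lin P ^ 2 * h"
    then obtain P h where P: "P \<noteq> (0, 0)" and h: "degree h + 2 \<le> s" "G = lin P ^ 2 * h" by blast
    show False
    proof (cases "fst P = 0")
      case True
      hence "G = Polynomial.smult (snd P ^ 2) h" using h by (simp add: lin_def power2_eq_square)
      hence "degree G < s" using h(1) degree_smult_le[of "snd P ^ 2" h] by simp
      thus False using Gs by (simp add: coeff_eq_0)
    next
      case False
      define z where "z = snd P / fst P"
      have "poly (lin P) z = 0" using False by (simp add: lin_def z_def)
      moreover have "pderiv G = lin P * pderiv (lin P * h) + (lin P * h) * pderiv (lin P)"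
        using pderiv_mult[of "lin P" "lin P * h"] h(2) by (simp only: power2_eq_square mult.assoc)
      ultimately have "poly G z = 0" "poly (pderiv G) z = 0" using h(2) by auto
      hence AB: "poly A z = - c * poly B z" "poly (pderiv A) z = - c * poly (pderiv B) z"
        by (simp_all add: G_def pderiv_add pderiv_smult eq_neg_iff_add_eq_0)
      hence "poly W z = 0" by (simp add: W_def)
      moreover have "poly B z \<noteq> 0" using noroot[of z] AB by auto
      hence "c = - poly A z / poly B z" using AB by (simp add: field_simps)
      ultimately show False using c by (auto simp: bad_def)
    qed
  qed
  moreover have "G \<noteq> 0" using Gs by auto
  ultimately show ?thesis using that[of c] by (simp add: G_def)
qed

section \<open>Sums of powers: upper and lower bounds\<close>

lemma degree_prod_lin_le: "finite A \<Longrightarrow> degree (\<Prod>i\<in>A. lin (P i)) \<le> card A"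
proof (induction A rule: finite_induct)
  case (insert i A)
  thus ?case using degree_lin_mult[of "\<Prod>i\<in>A. lin (P i)" "card A" "P i"] by simp
qed simp

lemma form_eval_prod_lin:
  "form_eval r (\<Prod>i<r. lin (P i)) Q = (\<Prod>i<r. snd (P i) * fst Q - fst (P i) * snd Q)"
proof (induction r)
  case (Suc r)
  have "form_eval (Suc r) (lin (P r) * (\<Prod>i<r. lin (P i))) Q =
      (snd (P r) * fst Q - fst (P r) * snd Q) * form_eval r (\<Prod>i<r. lin (P i)) Q"
    by (rule form_eval_lin_mult[OF degree_prod_lin])
  thus ?case using Suc by (simp add: mult.commute)
qed (simp add: form_eval_1)

lemma form_splits:
  fixes g :: "'a::alg_closed_field poly"
  assumes "g \<noteq> 0" "degree g \<le> s"
  shows "\<exists>P c. c \<noteq> 0 \<and> (\<forall>i<s. P i \<noteq> (0, 0)) \<and> g = Polynomial.smult c (\<Prod>i<s. lin (P i))"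
  using assms
proof (induction s arbitrary: g)
  case 0
  then obtain c where "g = [:c:]" using degree0_coeffs by blast
  thus ?case using 0 by (intro exI[of _ "\<lambda>_. (0, 0)"] exI[of _ c]) auto
next
  case (Suc s)
  obtain Q where Q: "Q \<noteq> (0, 0)" "form_eval (Suc s) g Q = 0"
    using form_root_exists Suc.prems(2) by blast
  obtain h where h: "degree h \<le> s" "g = lin Q * h"
    using form_root_factor[OF Suc.prems(2) Q(2,1)] by blast
  hence "h \<noteq> 0" using Suc.prems by auto
  then obtain P c where P: "c \<noteq> 0" "\<forall>i<s. P i \<noteq> (0, 0)" "h = Polynomial.smult c (\<Prod>i<s. lin (P i))"
    using Suc.IH h(1) by blast
  have "(\<Prod>i<s. lin ((P(s := Q)) i)) = (\<Prod>i<s. lin (P i))"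
    by (intro prod.cong) auto
  hence "g = Polynomial.smult c (\<Prod>i<Suc s. lin ((P(s := Q)) i))"
    using h P by (simp add: mult.commute)
  moreover have "\<forall>i<Suc s. (P(s := Q)) i \<noteq> (0, 0)" using P Q by (auto simp: less_Suc_eq)
  ultimately show ?case using P(1) by blast
qed

lemma proportional_points:
  fixes P Q :: "'a::field \<times> 'a"
  assumes "P \<noteq> (0, 0)" "Q \<noteq> (0, 0)" "snd P * fst Q = fst P * snd Q"
  obtains c where "c \<noteq> 0" "fst Q = c * fst P" "snd Q = c * snd P"
proof (cases "fst P = 0")
  case True
  hence "snd P \<noteq> 0" "fst Q = 0" using assms by (auto simp: prod_eq_iff)
  moreover from this have "snd Q \<noteq> 0" using assms by (auto simp: prod_eq_iff)
  ultimately show ?thesis using True that[of "snd Q / snd P"] by simp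
next
  case False
  hence "fst Q \<noteq> 0" using assms by (auto simp: prod_eq_iff)
  thus ?thesis using False assms(3) that[of "fst Q / fst P"] by (simp add: field_simps)
qed

lemma lin_scale: "fst Q = c * fst P \<Longrightarrow> snd Q = c * snd P \<Longrightarrow> lin Q = Polynomial.smult c (lin P)"
  by (simp add: lin_def)

lemma squarefree_splits:
  fixes g :: "'a::alg_closed_field poly"
  assumes "g \<noteq> 0" "degree g \<le> s" "form_squarefree s g"
  obtains P c where "c \<noteq> 0" "independent_points s P" "g = Polynomial.smult c (\<Prod>i<s. lin (P i))"
proof -
  obtain P c where P: "c \<noteq> 0" "\<forall>i<s. P i \<noteq> (0, 0)" "g = Polynomial.smult c (\<Prod>i<s. lin (P i))"
    using form_splits assms(1,2) by blast
  have "snd (P i) * fst (P j) \<noteq> fst (P i) * snd (P j)" if ij: "i < s" "j < s" "i \<noteq> j" for i j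
  proof
    assume "snd (P i) * fst (P j) = fst (P i) * snd (P j)"
    then obtain b where "fst (P j) = b * fst (P i)" "snd (P j) = b * snd (P i)"
      using proportional_points P(2) ij by metis
    hence linj: "lin (P j) = Polynomial.smult b (lin (P i))" by (rule lin_scale)
    let ?R = "\<Prod>l\<in>{..<s} - {i} - {j}. lin (P l)"
    have "(\<Prod>l<s. lin (P l)) = lin (P i) * (lin (P j) * ?R)"
      using ij by (simp add: prod.remove[of "{..<s}" i] prod.remove[of "{..<s} - {i}" j])
    hence "g = lin (P i) ^ 2 * Polynomial.smult (b * c) ?R"
      using P(3) linj by (simp add: power2_eq_square mult_ac)
    moreover have "degree ?R + 2 \<le> s"
    proof -
      have "card ({..<s} - {i} - {j}) + 2 = s" using ij by simp
      thus ?thesis using degree_prod_lin_le[of "{..<s} - {i} - {j}" P] by simp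
    qed
    hence "degree (Polynomial.smult (b * c) ?R) + 2 \<le> s"
      using degree_smult_le[of "b * c" ?R] by linarith
    ultimately show False using assms(3) P(2) ij(1) unfolding form_squarefree_def by blast
  qed
  thus ?thesis using that P unfolding independent_points_def by blast
qed

text \<open>
  The form with sequence \<open>Z\<close> is a sum of \<open>r\<close> powers of linear forms; \<open>P i = (0, 0)\<close>, the zero
  linear form, is admitted.
\<close>

definition power_sum :: "nat \<Rightarrow> (nat \<Rightarrow> 'a::field) \<Rightarrow> nat \<Rightarrow> bool" where
  "power_sum d Z r \<longleftrightarrow> (\<exists>P. \<forall>j\<le>d. Z j = (\<Sum>i<r. power_seq d (P i) j))"

lemma power_seq_scale:
  "j \<le> d \<Longrightarrow> fst Q = b * fst P \<Longrightarrow> snd Q = b * snd P \<Longrightarrow> power_seq d Q j = b ^ d * power_seq d P j"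
  by (simp add: power_seq_def power_mult_distrib power_add[symmetric])

lemma power_sumI:
  fixes Z :: "nat \<Rightarrow> 'a::alg_closed_field"
  assumes "1 \<le> d" "\<And>j. j \<le> d \<Longrightarrow> Z j = (\<Sum>i<r. c i * power_seq d (P i) j)"
  shows "power_sum d Z r"
proof -
  have "\<exists>b. b ^ d = c i" for i using nth_root_exists[of d "c i"] assms(1) by auto
  then obtain b where b: "\<And>i. b i ^ d = c i" by metis
  have "Z j = (\<Sum>i<r. power_seq d (b i * fst (P i), b i * snd (P i)) j)" if "j \<le> d" for j
  proof -
    have "power_seq d (b i * fst (P i), b i * snd (P i)) j = c i * power_seq d (P i) j" for i
      using power_seq_scale[OF that, of "(b i * fst (P i), b i * snd (P i))" "b i" "P i"] b by simp
    thus ?thesis using assms(2)[OF that] by simp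
  qed
  thus ?thesis unfolding power_sum_def
    by (intro exI[of _ "\<lambda>i. (b i * fst (P i), b i * snd (P i))"]) blast
qed

lemma power_sum_of_annihilator:
  fixes Z :: "nat \<Rightarrow> 'a::alg_closed_field"
  assumes "1 \<le> d" "annihilates d Z s g" "g \<noteq> 0" "form_squarefree s g"
  shows "power_sum d Z s"
proof -
  obtain P c where P: "c \<noteq> 0" "independent_points s P" "g = Polynomial.smult c (\<Prod>i<s. lin (P i))"
    using squarefree_splits[OF assms(3) annihilates_degree[OF assms(2)] assms(4)] by blast
  have "annihilates d Z s (\<Prod>i<s. lin (P i))"
    using annihilates_smult[OF assms(2), of "1 / c"] P by simp
  thus ?thesis using apolarity[OF P(2)] power_sumI[OF assms(1)] by blast
qed

text \<open>
  Proportional linear forms are merged and zero ones dropped, at the price of coefficients.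
\<close>

lemma power_sum_independent:
  fixes P :: "nat \<Rightarrow> 'a::field \<times> 'a"
  assumes "1 \<le> d"
  shows "\<exists>r'\<le>r. \<exists>Q c. independent_points r' Q \<and>
    (\<forall>j\<le>d. (\<Sum>i<r. power_seq d (P i) j) = (\<Sum>i<r'. c i * power_seq d (Q i) j))"
proof (induction r)
  case 0
  show ?case by (intro exI[of _ 0]) (simp add: independent_points_def)
next
  case (Suc r)
  then obtain r' Q c where IH: "r' \<le> r" "independent_points r' Q"
    "\<And>j. j \<le> d \<Longrightarrow> (\<Sum>i<r. power_seq d (P i) j) = (\<Sum>i<r'. c i * power_seq d (Q i) j)" by blast
  consider "P r = (0, 0)" | l where "P r \<noteq> (0, 0)" "l < r'" "snd (Q l) * fst (P r) = fst (Q l) * snd (P r)"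
    | "P r \<noteq> (0, 0)" "\<And>l. l < r' \<Longrightarrow> snd (Q l) * fst (P r) \<noteq> fst (Q l) * snd (P r)" by blast
  thus ?case
  proof cases
    case 1
    have "power_seq d (P r) j = 0" if "j \<le> d" for j
      using assms that 1 by (auto simp: power_seq_def)
    thus ?thesis using IH by (intro exI[of _ r'] conjI exI[of _ Q] exI[of _ c]) auto
  next
    case (2 l)
    have "Q l \<noteq> (0, 0)" using IH(2) 2 by (auto simp: independent_points_def)
    then obtain b where b: "fst (P r) = b * fst (Q l)" "snd (P r) = b * snd (Q l)"
      using proportional_points 2 by metis
    have "(\<Sum>i<Suc r. power_seq d (P i) j) = (\<Sum>i<r'. (c(l := c l + b ^ d)) i * power_seq d (Q i) j)"
      if "j \<le> d" for j
    proof -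
      have "(\<Sum>i<r'. (c(l := c l + b ^ d)) i * power_seq d (Q i) j)
          = (\<Sum>i<r'. c i * power_seq d (Q i) j + (if i = l then b ^ d * power_seq d (Q l) j else 0))"
        by (intro sum.cong) (auto simp: algebra_simps)
      also have "\<dots> = (\<Sum>i<r'. c i * power_seq d (Q i) j) + b ^ d * power_seq d (Q l) j"
        using 2(2) by (simp add: sum.distrib)
      finally show ?thesis using IH(3)[OF that] power_seq_scale[OF that b] by simp
    qed
    thus ?thesis using IH(1,2) by (intro exI[of _ r'] conjI exI[of _ Q] exI[of _ "c(l := c l + b ^ d)"]) auto
  next
    case 3
    have "independent_points (Suc r') (Q(r' := P r))"
      unfolding independent_points_def
    proof safe
      fix i assume "i < Suc r'" "(Q(r' := P r)) i = (0, 0)"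
      thus False using IH(2) 3(1) by (auto simp: independent_points_def less_Suc_eq split: if_splits)
    next
      fix i j assume ij: "i < Suc r'" "j < Suc r'" "i \<noteq> j"
        "snd ((Q(r' := P r)) i) * fst ((Q(r' := P r)) j) = fst ((Q(r' := P r)) i) * snd ((Q(r' := P r)) j)"
      show False
      proof (cases "i < r' \<and> j < r'")
        case True
        thus False using ij IH(2) by (auto simp: independent_points_def)
      next
        case False
        hence "i = r' \<and> j < r' \<or> j = r' \<and> i < r'" using ij by linarith
        thus False using ij(4) 3(2)[of i] 3(2)[of j] by (auto simp: mult.commute)
      qed
    qed
    moreover have "(\<Sum>i<Suc r. power_seq d (P i) j) =
        (\<Sum>i<Suc r'. (c(r' := 1)) i * power_seq d ((Q(r' := P r)) i) j)" if "j \<le> d" for j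
    proof -
      have "(\<Sum>i<r'. (c(r' := 1)) i * power_seq d ((Q(r' := P r)) i) j)
         = (\<Sum>i<r'. c i * power_seq d (Q i) j)" by (intro sum.cong) auto
      thus ?thesis using IH(3)[OF that] by simp
    qed
    ultimately show ?thesis using IH(1)
      by (intro exI[of _ "Suc r'"] conjI exI[of _ "Q(r' := P r)"] exI[of _ "c(r' := 1)"]) (auto simp del: fun_upd_apply)
  qed
qed

lemma annihilates_power_sum:
  fixes Z :: "nat \<Rightarrow> 'a::field"
  assumes "\<And>j. j \<le> d \<Longrightarrow> Z j = (\<Sum>i<r. c i * power_seq d (P i) j)"
  shows "annihilates d Z r (\<Prod>i<r. lin (P i))"
  unfolding annihilates_def
proof safe
  let ?g = "\<Prod>i<r. lin (P i)"
  show "degree ?g \<le> r" by (rule degree_prod_lin)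
  fix h :: "'a poly" assume h: "degree h + r \<le> d"
  have deg: "degree (?g * h) \<le> d" using degree_mult_le[of ?g h] degree_prod_lin[of P r] h by linarith
  have "apol Z (?g * h) = (\<Sum>j\<le>d. coeff (?g * h) j * (\<Sum>i<r. c i * power_seq d (P i) j))"
    unfolding apol_bound[OF deg] using assms by simp
  also have "\<dots> = (\<Sum>i<r. c i * form_eval d (?g * h) (P i))"
    unfolding form_eval_def apol_bound[OF deg] sum_distrib_left
    by (subst sum.swap) (simp add: mult_ac)
  also have "\<dots> = 0"
  proof (intro sum.neutral ballI)
    fix i assume i: "i \<in> {..<r}"
    have "form_eval (r + (d - r)) (?g * h) (P i) = form_eval r ?g (P i) * form_eval (d - r) h (P i)"
      using h by (intro form_eval_mult degree_prod_lin) auto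
    moreover have "form_eval r ?g (P i) = 0"
      unfolding form_eval_prod_lin using i by (intro prod_zero bexI[of _ i]) (auto simp: mult.commute)
    ultimately show "c i * form_eval d (?g * h) (P i) = 0" using h by simp
  qed
  finally show "apol Z (?g * h) = 0" .
qed

text \<open>
  Independent points that represent \<open>Z\<close> give a squarefree annihilator. With at most \<open>d + 1 - a\<close> of
  them, the minimal annihilator \<open>f\<close> would divide it and be squarefree too.
\<close>

lemma double_root_lower_bound:
  fixes Z :: "nat \<Rightarrow> 'a::alg_closed_field"
  assumes min: "minimal_annihilator d Z a f" and d: "1 \<le> d"
    and sq: "\<not> form_squarefree a f" and ps: "power_sum d Z s"
  shows "d + 2 \<le> a + s"
proof (rule ccontr)
  assume "\<not> d + 2 \<le> a + s"
  hence as: "a + s \<le> Suc d" by simp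
  obtain P0 where P0: "\<And>j. j \<le> d \<Longrightarrow> Z j = (\<Sum>i<s. power_seq d (P0 i) j)"
    using ps by (auto simp: power_sum_def)
  obtain r P c where P: "r \<le> s" "independent_points r P"
      "\<And>j. j \<le> d \<Longrightarrow> Z j = (\<Sum>i<r. c i * power_seq d (P i) j)"
    using power_sum_independent[OF d, of s P0] P0 by auto
  let ?g = "\<Prod>i<r. lin (P i)"
  have "annihilates d Z r ?g" by (rule annihilates_power_sum[OF P(3)])
  moreover have "a + r \<le> Suc d" using as P(1) by simp
  ultimately have "form_dvd a f r ?g" using min minimal_annihilator_form_dvd by blast
  moreover have "?g \<noteq> 0" using P(2) by (auto simp: independent_points_def)
  ultimately obtain h where h: "degree h + a \<le> r" "?g = f * h" by (auto simp: form_dvd_def)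
  obtain Q e where Q: "Q \<noteq> (0, 0)" "degree e + 2 \<le> a" "f = lin Q ^ 2 * e"
    using sq by (auto simp: form_squarefree_def)
  define k where "k = lin Q * (e * h)"
  have g: "?g = lin Q * k" using h Q by (simp add: k_def power2_eq_square mult_ac)
  obtain r' where r': "r = Suc r'" using h(1) Q(2) by (cases r) auto
  have eh: "degree (e * h) \<le> r' - 1" "1 \<le> r'" using degree_mult_le[of e h] h(1) Q(2) r' by linarith+
  have kdeg: "degree k \<le> r'" using degree_lin_mult[OF eh(1), of Q] eh(2) by (simp add: k_def)
  have kQ: "form_eval r' k Q = 0"
    using form_eval_lin_mult[OF eh(1), of Q Q] eh(2) by (simp add: k_def mult.commute)
  have "form_eval r ?g Q = 0"
    using form_eval_lin_mult[OF kdeg, of Q Q] g r' by (simp add: mult.commute)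
  then obtain i where i: "i < r" "snd (P i) * fst Q = fst (P i) * snd Q"
    unfolding form_eval_prod_lin by auto
  have Pi: "P i \<noteq> (0, 0)" using P(2) i by (auto simp: independent_points_def)
  obtain b where b: "b \<noteq> 0" "fst Q = b * fst (P i)" "snd Q = b * snd (P i)"
    using proportional_points[OF Pi Q(1) i(2)] by blast
  let ?R = "\<Prod>l\<in>{..<r} - {i}. lin (P l)"
  have "lin (P i) * ?R = lin (P i) * Polynomial.smult b k"
    using g i lin_scale[OF b(2,3)] by (simp add: prod.remove[of "{..<r}" i] mult_ac)
  hence R: "?R = Polynomial.smult b k"
    using Pi iffD1[OF mult_left_cancel] lin_eq_0_iff by blast
  have fe: "form_eval (card A) (\<Prod>l\<in>A. lin (P l)) Q = (\<Prod>l\<in>A. snd (P l) * fst Q - fst (P l) * snd Q)"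
    if "finite A" for A
    using that
  proof (induction A rule: finite_induct)
    case (insert l A)
    thus ?case using form_eval_lin_mult[OF degree_prod_lin_le[of A P], of "P l" Q] by simp
  qed (simp add: form_eval_1)
  have "form_eval r' ?R Q = (\<Prod>l\<in>{..<r} - {i}. snd (P l) * fst Q - fst (P l) * snd Q)"
    using fe[of "{..<r} - {i}"] i r' by simp
  moreover have "form_eval r' ?R Q = 0" using R kQ by (simp add: form_eval_smult)
  ultimately obtain l where l: "l < r" "l \<noteq> i" "snd (P l) * fst Q = fst (P l) * snd Q" by auto
  hence "snd (P l) * fst (P i) = fst (P l) * snd (P i)" using b by (simp add: field_simps)
  thus False using P(2) l i by (auto simp: independent_points_def)
qed

text \<open>
  The minimal annihilator, raised to degree \<open>d + 2 - a\<close> by a power of a linear form at whose root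
  \<open>g\<close> does not vanish, spans with the second generator \<open>g\<close> a pencil of coprime annihilators.
\<close>

lemma power_sum_upper_bound:
  fixes Z :: "nat \<Rightarrow> 'a::{alg_closed_field, field_char_0}"
  assumes min: "minimal_annihilator d Z a f" and a: "1 \<le> a" "2 * a \<le> d + 2" and d: "1 \<le> d"
  shows "power_sum d Z (d + 2 - a)"
proof -
  define s where "s = d + 2 - a"
  have f: "f \<noteq> 0" "annihilates d Z a f" using min by (auto simp: minimal_annihilator_def)
  obtain g where g: "g \<noteq> 0" "annihilates d Z s g"
    "\<And>P. P \<noteq> (0, 0) \<Longrightarrow> form_eval a f P = 0 \<Longrightarrow> form_eval s g P \<noteq> 0"
    using coprime_annihilator_exists[OF min a d] unfolding s_def by blast
  have gdeg: "degree g \<le> s" using annihilates_degree g(2) .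
  have "finite {z. poly g z = 0}" using g(1) poly_roots_finite by blast
  then obtain z where z: "poly g z \<noteq> 0" using ex_new_if_finite infinite_UNIV_char_0 by blast
  define Q where "Q = (1 :: 'a, z)"
  define t where "t = s - a"
  have s: "s = a + t" using a by (simp add: s_def t_def)
  have gQ: "form_eval s g Q \<noteq> 0" using z gdeg by (simp add: form_eval_affine Q_def)
  define A where "A = f * lin Q ^ t"
  have Qt: "degree (lin Q ^ t) \<le> t" using degree_prod_lin[of "\<lambda>_. Q" t] by simp
  have A: "annihilates d Z s A" unfolding A_def using Qt s by (intro annihilates_mult[OF f(2)]) simp
  have "form_eval s g P \<noteq> 0" if P: "P \<noteq> (0, 0)" "form_eval s A P = 0" for P
  proof -
    have "form_eval s A P = form_eval a f P * form_eval t (lin Q ^ t) P"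
      unfolding A_def s by (rule form_eval_mult[OF annihilates_degree[OF f(2)] Qt])
    also have "form_eval t (lin Q ^ t) P = (snd Q * fst P - fst Q * snd P) ^ t"
      using form_eval_prod_lin[of t "\<lambda>_. Q" P] by simp
    finally consider "form_eval a f P = 0" | "snd Q * fst P = fst Q * snd P" using P(2) by auto
    thus ?thesis
    proof cases
      case 2
      hence "snd P = z * fst P" by (simp add: Q_def)
      moreover from this have "fst P \<noteq> 0" using P(1) by (auto simp: prod_eq_iff)
      ultimately show ?thesis using z gdeg by (simp add: form_eval_affine)
    qed (use g(3) P(1) in blast)
  qed
  moreover have "1 \<le> s" using a by (simp add: s_def)
  ultimately obtain c where c: "A + Polynomial.smult c g \<noteq> 0" "form_squarefree s (A + Polynomial.smult c g)"
    using pencil_squarefree[of A s g] annihilates_degree[OF A] gdeg by blast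
  have "annihilates d Z s (A + Polynomial.smult c g)"
    by (intro annihilates_add annihilates_smult A g(2))
  thus ?thesis using power_sum_of_annihilator[OF d _ c] s_def by blast
qed

section \<open>Polynomial functions that bound the rank from below\<close>

text \<open>
  Minimality says that no nonzero form of degree \<open>a\<close> annihilates, so that
  \<open>g \<mapsto> (apol Z (y^i g))\<^sub>i\<close> is injective in degree \<open>a\<close>. The rows of \<open>B\<close> are those of a left inverse.
\<close>

lemma dual_system:
  fixes Z :: "nat \<Rightarrow> 'a::field"
  assumes min: "minimal_annihilator d Z (Suc a) f" and a: "a \<le> d"
  obtains B where "\<And>j l. j \<le> a \<Longrightarrow> l \<le> a \<Longrightarrow>
    (\<Sum>i\<le>d - a. B j i * Z (l + i)) = (if j = l then 1 else 0)"
proof -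
  interpret VP: vector_space_pair "Polynomial.smult :: 'a \<Rightarrow> 'a poly \<Rightarrow> 'a poly" Polynomial.smult
    by unfold_locales (auto simp: smult_add_right smult_add_left)
  define h where "h g = (\<Sum>i\<le>d - a. Polynomial.monom (apol (\<lambda>j. Z (i + j)) g) i)" for g
  have coeff_h: "coeff (h g) i = apol (\<lambda>j. Z (i + j)) g" if "i \<le> d - a" for g i
    using that by (simp add: h_def coeff_sum if_distrib cong: if_cong)
  have lin: "Vector_Spaces.linear Polynomial.smult Polynomial.smult h"
    unfolding Vector_Spaces.linear_iff
  proof (intro conjI allI)
    fix x y show "h (x + y) = h x + h y"
      by (simp add: h_def apol_add add_monom[symmetric] sum.distrib)
  next
    fix c x show "h (Polynomial.smult c x) = Polynomial.smult c (h x)"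
      by (simp add: h_def apol_smult smult_monom[symmetric] VP.vs1.scale_sum_right)
  qed (fact VP.vs1.vector_space_axioms)+
  let ?S = "(\<lambda>l. Polynomial.monom (1::'a) l) ` {..a}"
  have deg: "degree g \<le> a" if "g \<in> VP.vs1.span ?S" for g
    using that
  proof (induction rule: VP.vs1.span_induct_alt)
    case (step c x y)
    have "degree x \<le> a" using step(1) by (auto simp: degree_monom_eq)
    thus ?case using step(2) degree_smult_le[of c x] by (intro degree_add_le) linarith+
  qed simp
  have "inj_on h (VP.vs1.span ?S)"
  proof (rule inj_onI)
    fix x y assume xy: "x \<in> VP.vs1.span ?S" "y \<in> VP.vs1.span ?S" "h x = h y"
    have "degree (x - y) \<le> a" using deg xy by (intro degree_diff_le) auto
    moreover have "apol (\<lambda>j. Z (i + j)) (x - y) = 0" if "i \<le> d - a" for i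
      using coeff_h[OF that, of x] coeff_h[OF that, of y] xy(3) by (simp add: apol_diff)
    ultimately have "annihilates d Z a (x - y)" using annihilates_iff_rows a by blast
    hence "x - y = 0" using min unfolding minimal_annihilator_def by blast
    thus "x = y" by simp
  qed
  then obtain G where G: "Vector_Spaces.linear Polynomial.smult Polynomial.smult G"
      "\<And>x. x \<in> VP.vs1.span ?S \<Longrightarrow> G (h x) = x"
    using VP.linear_inj_on_left_inverse[OF lin] by blast
  interpret G: Vector_Spaces.linear Polynomial.smult Polynomial.smult G by (fact G(1))
  show ?thesis
  proof (rule that[of "\<lambda>j i. coeff (G (Polynomial.monom 1 i)) j"])
    fix j l assume jl: "j \<le> a" "l \<le> a"
    have "h (Polynomial.monom 1 l) =
        (\<Sum>i\<le>d - a. Polynomial.smult (Z (l + i)) (Polynomial.monom 1 i))"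
      by (simp add: h_def apol_monom smult_monom add.commute)
    hence "G (h (Polynomial.monom 1 l)) =
        (\<Sum>i\<le>d - a. Polynomial.smult (Z (l + i)) (G (Polynomial.monom 1 i)))"
      by (simp add: G.sum G.scale)
    moreover have "G (h (Polynomial.monom 1 l)) = Polynomial.monom 1 l"
      using jl by (intro G(2) VP.vs1.span_base) auto
    ultimately have "(\<Sum>i\<le>d - a. Polynomial.smult (Z (l + i)) (G (Polynomial.monom 1 i)))
        = Polynomial.monom 1 l" by simp
    hence "coeff (\<Sum>i\<le>d - a. Polynomial.smult (Z (l + i)) (G (Polynomial.monom 1 i))) j
        = (if j = l then 1 else 0)" by simp
    thus "(\<Sum>i\<le>d - a. coeff (G (Polynomial.monom 1 i)) j * Z (l + i)) = (if j = l then 1 else 0)"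
      by (simp add: coeff_sum mult.commute)
  qed
qed

text \<open>
  A fixed linear combination of rows of a Hankel matrix of \<open>Z\<close>: its determinant is a fixed
  combination of maximal minors, which plays the role of one nonvanishing minor.
\<close>

definition minor_mat :: "(nat \<Rightarrow> nat \<Rightarrow> 'a::field) \<Rightarrow> nat \<Rightarrow> nat \<Rightarrow> (nat \<Rightarrow> 'a) \<Rightarrow> 'a mat" where
  "minor_mat B d a Z = mat (Suc a) (Suc a) (\<lambda>(j, l). \<Sum>i\<le>d - a. B j i * Z (l + i))"

text \<open>
  The matrix factors through a space of dimension \<open>s \<le> a\<close>, since each power contributes a rank one
  Hankel matrix; a vector \<open>x\<close> orthogonal to the evaluations at all \<open>s\<close> points lies in the kernel.
\<close>

lemma det_minor_mat_power_sum:
  fixes Y :: "nat \<Rightarrow> 'a::field"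
  assumes ps: "power_sum d Y s" and s: "s \<le> a" and a: "a \<le> d"
  shows "det (minor_mat B d a Y) = 0"
proof -
  obtain P where P: "\<And>j. j \<le> d \<Longrightarrow> Y j = (\<Sum>t<s. power_seq d (P t) j)"
    using ps by (auto simp: power_sum_def)
  obtain x where x: "\<exists>l<Suc a. x l \<noteq> 0" "\<And>t. t < s \<Longrightarrow> (\<Sum>l<Suc a. power_seq a (P t) l * x l) = 0"
    using underdetermined_system[of s "Suc a" "\<lambda>t. power_seq a (P t)"] s by auto
  let ?v = "vec (Suc a) x"
  have split: "power_seq d (P t) (l + i) = power_seq a (P t) l * power_seq (d - a) (P t) i"
    if "l \<le> a" "i \<le> d - a" for l i t
  proof -
    have "d - (l + i) = (a - l) + (d - a - i)" using that a by simp
    thus ?thesis by (simp add: power_seq_def power_add)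
  qed
  have "minor_mat B d a Y *\<^sub>v ?v = 0\<^sub>v (Suc a)"
  proof (rule eq_vecI)
    fix j assume "j < dim_vec (0\<^sub>v (Suc a))"
    hence j: "j < Suc a" by simp
    have "(minor_mat B d a Y *\<^sub>v ?v) $ j = (\<Sum>l<Suc a. (\<Sum>i\<le>d - a. B j i * Y (l + i)) * x l)"
      using j by (simp add: minor_mat_def scalar_prod_def atLeast0LessThan del: sum.lessThan_Suc)
    also have "\<dots> = (\<Sum>l<Suc a. \<Sum>i\<le>d - a. \<Sum>t<s.
        (B j i * power_seq (d - a) (P t) i) * (power_seq a (P t) l * x l))"
      unfolding sum_distrib_right
    proof (intro sum.cong refl)
      fix l i assume "l \<in> {..<Suc a}" "i \<in> {..d - a}"
      hence li: "l \<le> a" "i \<le> d - a" by auto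
      have "Y (l + i) = (\<Sum>t<s. power_seq a (P t) l * power_seq (d - a) (P t) i)"
        using P[of "l + i"] li a split by simp
      thus "B j i * Y (l + i) * x l = (\<Sum>t<s. (B j i * power_seq (d - a) (P t) i) * (power_seq a (P t) l * x l))"
        by (simp add: sum_distrib_left sum_distrib_right mult_ac)
    qed
    also have "\<dots> = (\<Sum>i\<le>d - a. \<Sum>l<Suc a. \<Sum>t<s.
        (B j i * power_seq (d - a) (P t) i) * (power_seq a (P t) l * x l))"
      by (rule sum.swap)
    also have "\<dots> = (\<Sum>i\<le>d - a. \<Sum>t<s. (B j i * power_seq (d - a) (P t) i) *
        (\<Sum>l<Suc a. power_seq a (P t) l * x l))"
      unfolding sum_distrib_left by (intro sum.cong refl sum.swap)
    also have "\<dots> = 0" using x(2) by (intro sum.neutral ballI) (simp del: sum.lessThan_Suc)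
    finally show "(minor_mat B d a Y *\<^sub>v ?v) $ j = 0\<^sub>v (Suc a) $ j" using j by simp
  qed (simp add: minor_mat_def)
  moreover have "?v \<noteq> 0\<^sub>v (Suc a)" using x(1) by (metis index_vec index_zero_vec(1))
  moreover have "?v \<in> carrier_vec (Suc a)" "minor_mat B d a Y \<in> carrier_mat (Suc a) (Suc a)"
    by (simp_all add: minor_mat_def)
  ultimately show ?thesis using det_0_iff_vec_prod_zero_field by blast
qed

lemma det_minor_mat_dual:
  assumes "\<And>j l. j \<le> a \<Longrightarrow> l \<le> a \<Longrightarrow> (\<Sum>i\<le>d - a. B j i * Z (l + i)) = (if j = l then 1 else 0)"
  shows "det (minor_mat B d a Z) = 1"
proof -
  have "minor_mat B d a Z = 1\<^sub>m (Suc a)"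
    using assms by (intro eq_matI) (auto simp: minor_mat_def)
  thus ?thesis by simp
qed

lemma polynomial_fun_sum:
  "(\<And>i. i \<in> A \<Longrightarrow> polynomial_fun d (\<phi> i)) \<Longrightarrow> polynomial_fun d (\<lambda>q. \<Sum>i\<in>A. \<phi> i q)"
  by (induction A rule: infinite_finite_induct) (auto intro: polynomial_fun.intros)

lemma polynomial_fun_prod:
  "(\<And>i. i \<in> A \<Longrightarrow> polynomial_fun d (\<phi> i)) \<Longrightarrow> polynomial_fun d (\<lambda>q. \<Prod>i\<in>A. \<phi> i q)"
  by (induction A rule: infinite_finite_induct) (auto intro: polynomial_fun.intros)

lemma polynomial_fun_det_minor_mat:
  assumes \<zeta>: "\<And>j. j \<le> d \<Longrightarrow> polynomial_fun d (\<lambda>q. \<zeta> q j)" and a: "a \<le> d"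
  shows "polynomial_fun d (\<lambda>q. det (minor_mat B d a (\<zeta> q)))"
proof -
  have "det (minor_mat B d a (\<zeta> q)) = (\<Sum>p\<in>{p. p permutes {0..<Suc a}}.
      signof p * (\<Prod>j = 0..<Suc a. \<Sum>i\<le>d - a. B j i * \<zeta> q (p j + i)))" for q
  proof -
    have "minor_mat B d a (\<zeta> q) $$ (j, p j) = (\<Sum>i\<le>d - a. B j i * \<zeta> q (p j + i))"
      if "p permutes {0..<Suc a}" "j < Suc a" for p j
      using permutes_in_image[OF that(1), of j] that(2) by (simp add: minor_mat_def)
    thus ?thesis
      by (subst det_def'[of _ "Suc a"]) (auto simp: minor_mat_def intro!: sum.cong prod.cong)
  qed
  moreover have "polynomial_fun d (\<lambda>q. \<Sum>p\<in>{p. p permutes {0..<Suc a}}.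
      signof p * (\<Prod>j = 0..<Suc a. \<Sum>i\<le>d - a. B j i * \<zeta> q (p j + i)))"
  proof (intro polynomial_fun_sum polynomial_fun.mult polynomial_fun_prod polynomial_fun.const_fun \<zeta>)
    fix p j i assume "p \<in> {p. p permutes {0..<Suc a}}" "j \<in> {0..<Suc a}" "i \<in> {..d - a}"
    hence "p j < Suc a" "i \<le> d - a" using permutes_in_image[of p "{0..<Suc a}" j] by auto
    thus "p j + i \<le> d" using a by simp
  qed
  ultimately show ?thesis by simp
qed

section \<open>Binary forms as polynomials in two variables\<close>

lemma const_monom: "const c = Polynomial.monom (Polynomial.monom c 0) 0"
  by (simp add: const_def monom_0)

lemma var_x_power: "var_x ^ m = Polynomial.monom (Polynomial.monom 1 m) 0"
proof -
  have x: "var_x = Polynomial.monom (Polynomial.monom 1 1) 0"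
    by (simp add: var_x_def monom_0 monom_Suc)
  show ?thesis unfolding x by (simp add: monom_power)
qed

lemma var_y_power: "var_y ^ n = Polynomial.monom 1 n"
proof -
  have y: "var_y = Polynomial.monom 1 1"
    by (simp add: var_y_def monom_0 monom_Suc)
  show ?thesis unfolding y by (simp add: monom_power)
qed

text \<open>
  The binary form with given coefficients, dehomogenized by \<open>x = 1\<close> to \<open>\<Sum>i\<le>s. v i y^i\<close>.
\<close>

definition bform :: "nat \<Rightarrow> (nat \<Rightarrow> 'a::field) \<Rightarrow> 'a poly poly" where
  "bform s v = (\<Sum>i\<le>s. const (v i) * var_x ^ (s - i) * var_y ^ i)"

lemma bform_monom: "bform s v = (\<Sum>i\<le>s. Polynomial.monom (Polynomial.monom (v i) (s - i)) i)"
  by (simp add: bform_def const_monom var_x_power var_y_power mult_monom)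

lemma coeff_bform: "coeff (bform s v) j = (if j \<le> s then Polynomial.monom (v j) (s - j) else 0)"
  by (simp add: bform_monom coeff_sum if_distrib cong: if_cong)

lemma bform_mem: "bform s v \<in> binary_forms s"
  by (auto simp: binary_forms_def coeff_bform split: if_splits)

lemma binary_form_eq_bform:
  assumes "p \<in> binary_forms s"
  shows "p = bform s (\<lambda>j. coeff (coeff p j) (s - j))"
proof (intro poly_eqI)
  fix j i
  show "coeff (coeff p j) i = coeff (coeff (bform s (\<lambda>j. coeff (coeff p j) (s - j))) j) i"
    using assms by (cases "i + j = s") (auto simp: coeff_bform binary_forms_def)
qed

lemma bform_eq_iff: "bform s v = bform s w \<longleftrightarrow> (\<forall>j\<le>s. v j = w j)"
proof
  assume eq: "bform s v = bform s w"
  show "\<forall>j\<le>s. v j = w j"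
  proof safe
    fix j assume "j \<le> s"
    thus "v j = w j" using arg_cong[OF eq, of "\<lambda>p. coeff (coeff p j) (s - j)"] by (simp add: coeff_bform)
  qed
qed (simp add: bform_def)

lemma bform_cong: "(\<And>j. j \<le> s \<Longrightarrow> v j = w j) \<Longrightarrow> bform s v = bform s w"
  by (simp add: bform_eq_iff)

lemma bform_sum: "(\<Sum>i\<in>A. bform s (v i)) = bform s (\<lambda>j. \<Sum>i\<in>A. v i j)"
proof (intro poly_eqI)
  fix j i
  show "coeff (coeff (\<Sum>i\<in>A. bform s (v i)) j) i = coeff (coeff (bform s (\<lambda>j. \<Sum>i\<in>A. v i j)) j) i"
    by (simp add: coeff_sum coeff_bform)
qed

lemma const_mult_bform: "const c * bform s v = bform s (\<lambda>j. c * v j)"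
  by (simp add: bform_monom const_monom sum_distrib_left mult_monom)

lemma bform_mult:
  assumes "degree g \<le> s" "degree h \<le> t"
  shows "bform (s + t) (coeff (g * h)) = bform s (coeff g) * bform t (coeff h)"
proof (rule poly_eqI)
  fix n
  have "coeff (bform s (coeff g) * bform t (coeff h)) n =
      (\<Sum>j\<le>n. coeff (bform s (coeff g)) j * coeff (bform t (coeff h)) (n - j))"
    by (rule coeff_mult)
  also have "\<dots> = (\<Sum>j\<le>n. if n \<le> s + t then Polynomial.monom (coeff g j * coeff h (n - j)) (s + t - n) else 0)"
  proof (intro sum.cong refl)
    fix j assume "j \<in> {..n}"
    hence j: "j \<le> n" by simp
    show "coeff (bform s (coeff g)) j * coeff (bform t (coeff h)) (n - j) =
      (if n \<le> s + t then Polynomial.monom (coeff g j * coeff h (n - j)) (s + t - n) else 0)"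
    proof (cases "j \<le> s \<and> n - j \<le> t")
      case True
      hence "n \<le> s + t" "s - j + (t - (n - j)) = s + t - n" using j by auto
      thus ?thesis using True by (simp add: coeff_bform mult_monom)
    next
      case False
      hence "coeff g j * coeff h (n - j) = 0" using assms by (auto simp: coeff_eq_0)
      thus ?thesis using False by (auto simp: coeff_bform)
    qed
  qed
  also have "\<dots> = coeff (bform (s + t) (coeff (g * h))) n"
    by (simp add: coeff_bform coeff_mult[of g h] monom_sum)
  finally show "coeff (bform (s + t) (coeff (g * h))) n = coeff (bform s (coeff g) * bform t (coeff h)) n"
    by simp
qed

lemma eval_form_bform:
  assumes "degree g \<le> s"
  shows "eval_form (bform s (coeff g)) a b = form_eval s g (a, b)"
  unfolding eval_form_def bform_monom form_eval_bound[OF assms]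
  by (simp add: poly_sum poly_monom mult_ac)

lemma linear_form_lin: "const (snd P) * var_x - const (fst P) * var_y = bform 1 (coeff (lin P))"
proof -
  have "const (- fst P) = - const (fst P)" by (simp add: const_def)
  thus ?thesis by (simp add: bform_def lin_def)
qed

lemma linear_form_power:
  "(const t * var_x + const u * var_y) ^ d = bform d (\<lambda>j. of_nat (d choose j) * power_seq d (t, u) j)"
proof -
  have cp: "const c ^ m = const (c ^ m)" for c :: 'a and m
    by (simp add: const_monom monom_power)
  have cm: "const a * const b = const (a * b)" for a b :: 'a
    by (simp add: const_monom mult_monom)
  have cn: "of_nat m = (const (of_nat m) :: 'a poly poly)" for m
    by (simp add: const_def of_nat_poly)
  have "(const t * var_x + const u * var_y) ^ d
      = (\<Sum>k\<le>d. of_nat (d choose k) * (const u * var_y) ^ k * (const t * var_x) ^ (d - k))"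
    by (subst add.commute) (rule binomial_ring)
  also have "\<dots> = (\<Sum>k\<le>d. const (of_nat (d choose k) * power_seq d (t, u) k) * var_x ^ (d - k) * var_y ^ k)"
    by (intro sum.cong refl) (simp add: power_mult_distrib cp cn cm[symmetric] power_seq_def mult_ac)
  finally show ?thesis by (simp add: bform_def)
qed

text \<open>
  The normalization by binomial coefficients makes \<open>power_seq d P\<close> the sequence of a \<open>d\<close>th power.
\<close>

definition form_of :: "nat \<Rightarrow> (nat \<Rightarrow> 'a::field) \<Rightarrow> 'a poly poly" where
  "form_of d Z = bform d (\<lambda>i. of_nat (d choose i) * Z i)"

lemma form_of_eq_iff:
  fixes Z Y :: "nat \<Rightarrow> 'a::field_char_0"
  shows "form_of d Z = form_of d Y \<longleftrightarrow> (\<forall>j\<le>d. Z j = Y j)"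
  by (simp add: form_of_def bform_eq_iff)

lemma linear_forms_1:
  "L \<in> binary_forms 1 \<longleftrightarrow> (\<exists>t u. L = const t * var_x + const u * var_y)"
proof
  assume "L \<in> binary_forms 1"
  from binary_form_eq_bform[OF this] show "\<exists>t u. L = const t * var_x + const u * var_y"
    by (auto simp: bform_def)
next
  assume "\<exists>t u. L = const t * var_x + const u * var_y"
  then obtain t u where "L = const t * var_x + const u * var_y" by blast
  hence "L = bform 1 (\<lambda>j. if j = 0 then t else u)" by (simp add: bform_def)
  thus "L \<in> binary_forms 1" using bform_mem by metis
qed

lemma form_of_power_seq: "form_of d (power_seq d P) = (const (fst P) * var_x + const (snd P) * var_y) ^ d"
  by (simp add: form_of_def linear_form_power)

lemma form_of_sum: "form_of d (\<lambda>j. \<Sum>i\<in>A. Y i j) = (\<Sum>i\<in>A. form_of d (Y i))"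
  by (simp add: form_of_def bform_sum sum_distrib_left)

lemma form_of_scale: "form_of d (\<lambda>j. c * Y j) = const c * form_of d Y"
  by (simp add: form_of_def const_mult_bform mult.left_commute)

lemma power_sum_iff:
  fixes Z :: "nat \<Rightarrow> 'a::field_char_0"
  shows "power_sum d Z r \<longleftrightarrow>
    (\<exists>L :: nat \<Rightarrow> 'a poly poly. (\<forall>i<r. L i \<in> binary_forms 1) \<and> form_of d Z = (\<Sum>i<r. L i ^ d))"
proof
  assume "power_sum d Z r"
  then obtain P where "\<forall>j\<le>d. Z j = (\<Sum>i<r. power_seq d (P i) j)" by (auto simp: power_sum_def)
  hence "form_of d Z = form_of d (\<lambda>j. \<Sum>i<r. power_seq d (P i) j)" by (simp add: form_of_eq_iff)
  hence "form_of d Z = (\<Sum>i<r. (const (fst (P i)) * var_x + const (snd (P i)) * var_y) ^ d)"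
    by (simp add: form_of_sum form_of_power_seq)
  thus "\<exists>L. (\<forall>i<r. L i \<in> binary_forms 1) \<and> form_of d Z = (\<Sum>i<r. L i ^ d)"
    by (intro exI[of _ "\<lambda>i. const (fst (P i)) * var_x + const (snd (P i)) * var_y"])
       (use linear_forms_1 in auto)
next
  assume "\<exists>L. (\<forall>i<r. L i \<in> binary_forms 1) \<and> form_of d Z = (\<Sum>i<r. L i ^ d)"
  then obtain L where L: "\<forall>i<r. L i \<in> binary_forms 1" "form_of d Z = (\<Sum>i<r. L i ^ d)" by blast
  have "\<forall>i. \<exists>P. i < r \<longrightarrow> L i = const (fst P) * var_x + const (snd P) * var_y"
    using L(1) unfolding linear_forms_1 by (metis fst_conv snd_conv)
  then obtain P where P: "\<And>i. i < r \<Longrightarrow> L i = const (fst (P i)) * var_x + const (snd (P i)) * var_y"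
    by metis
  have "form_of d Z = (\<Sum>i<r. form_of d (power_seq d (P i)))"
    unfolding L(2) by (intro sum.cong) (auto simp: P form_of_power_seq)
  hence "form_of d Z = form_of d (\<lambda>j. \<Sum>i<r. power_seq d (P i) j)"
    by (simp add: form_of_sum)
  thus "power_sum d Z r" unfolding power_sum_def form_of_eq_iff by blast
qed

text \<open>
  The cofactor is an arbitrary polynomial in two variables. Setting \<open>x = 1\<close> gives the identity of
  polynomials, and comparing degrees bounds the cofactor when \<open>lin P\<close> has degree 1. For the point at
  infinity divisibility by \<open>x^2\<close> makes the two top coefficients of \<open>g\<close> vanish.
\<close>

lemma double_factor_of_bform_dvd:
  fixes g :: "'a::{field, ring_char_0} poly"
  assumes g: "g \<noteq> 0" "degree g \<le> s"
    and dvd: "bform 1 (coeff (lin P)) ^ 2 dvd bform s (coeff g)"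
  obtains h where "degree h + 2 \<le> s" "g = lin P ^ 2 * h"
proof -
  obtain p where p: "bform s (coeff g) = bform 1 (coeff (lin P)) ^ 2 * p" using dvd by (elim dvdE)
  show ?thesis
  proof (cases "fst P = 0")
    case False
    define h where "h = (\<Sum>j\<le>degree p. Polynomial.monom (poly (coeff p j) 1) j)"
    have hb: "poly h b = eval_form p 1 b" for b
      by (simp add: h_def eval_form_def poly_altdef[of p] poly_sum poly_monom poly_power)
    have "poly g b = poly (lin P ^ 2 * h) b" for b
    proof -
      have "poly g b = eval_form (bform s (coeff g)) 1 b"
        using g(2) by (simp add: eval_form_bform form_eval_affine)
      also have "\<dots> = eval_form (bform 1 (coeff (lin P))) 1 b ^ 2 * eval_form p 1 b"
        unfolding p by (simp add: eval_form_def)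
      also have "eval_form (bform 1 (coeff (lin P))) 1 b = poly (lin P) b"
        using eval_form_bform[OF degree_lin_le, of P 1 b] form_eval_affine[OF degree_lin_le, of "(1, b)" P] by simp
      finally show ?thesis by (simp add: hb)
    qed
    hence eq: "g = lin P ^ 2 * h" using poly_eq_poly_eq_iff[of g "lin P ^ 2 * h"] by blast
    hence "h \<noteq> 0" "lin P \<noteq> 0" using g(1) by auto
    hence "degree g = 2 * degree (lin P) + degree h"
      unfolding eq by (subst degree_mult_eq) (auto simp: degree_power_eq)
    moreover have "degree (lin P) = 1" using False by (simp add: lin_def)
    ultimately show ?thesis using that eq g(2) by simp
  next
    case True
    define c where "c = snd P"
    have "bform 1 (coeff (lin P)) = Polynomial.monom (Polynomial.monom c 1) 0"
      using True by (simp add: bform_monom lin_def c_def)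
    hence p': "bform s (coeff g) = Polynomial.smult (Polynomial.monom (c ^ 2) 2) p"
      unfolding p by (simp add: monom_0 power2_eq_square mult_monom numeral_2_eq_2)
    have low: "coeff g j = 0" if "s < j + 2" for j
    proof (cases "j \<le> s")
      case True
      have "coeff (coeff (bform s (coeff g)) j) (s - j) = coeff g j"
        using True by (simp add: coeff_bform)
      moreover have "s - j < 2" using that by simp
      ultimately show ?thesis unfolding p' by (simp add: coeff_monom_mult)
    next
      case False
      thus ?thesis using g(2) by (simp add: coeff_eq_0)
    qed
    have "lead_coeff g \<noteq> 0" using g(1) by simp
    hence deg: "degree g + 2 \<le> s" using low[of "degree g"] by (meson not_le)
    have "c \<noteq> 0"
    proof
      assume "c = 0"
      hence "bform s (coeff g) = bform s (\<lambda>_. 0)" unfolding p' by (simp add: bform_monom)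
      hence "\<forall>j\<le>s. coeff g j = 0" by (simp add: bform_eq_iff)
      thus False using g by auto
    qed
    hence "g = lin P ^ 2 * Polynomial.smult (1 / c ^ 2) g"
      using True by (simp add: lin_def c_def power2_eq_square)
    moreover have "degree (Polynomial.smult (1 / c ^ 2) g) + 2 \<le> s"
      using deg degree_smult_le[of "1 / c ^ 2" g] by linarith
    ultimately show ?thesis using that by blast
  qed
qed

lemma multiple_root_iff:
  fixes g :: "'a::field_char_0 poly"
  assumes g: "g \<noteq> 0" "degree g \<le> s"
  shows "(\<exists>P. is_multiple_root (bform s (coeff g)) P) \<longleftrightarrow> \<not> form_squarefree s g"
proof
  assume "\<exists>P. is_multiple_root (bform s (coeff g)) P"
  then obtain P where P: "P \<noteq> (0, 0)" "bform 1 (coeff (lin P)) ^ 2 dvd bform s (coeff g)"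
    unfolding is_multiple_root_def homogeneous_coords_def linear_form_lin by blast
  thus "\<not> form_squarefree s g"
    using double_factor_of_bform_dvd[OF g P(2)] unfolding form_squarefree_def by metis
next
  assume "\<not> form_squarefree s g"
  then obtain P h where P: "P \<noteq> (0, 0)" "degree h + 2 \<le> s" "g = lin P ^ 2 * h"
    unfolding form_squarefree_def by blast
  let ?L = "bform 1 (coeff (lin P))"
  obtain e where e: "s = 2 + e" "degree h \<le> e" using P(2) by (metis add.commute add_le_cancel_left le_iff_add add_leD2)
  have "bform s (coeff g) = bform (2 + e) (coeff (lin P ^ 2 * h))" unfolding P(3) e(1) ..
  also have "\<dots> = bform 2 (coeff (lin P ^ 2)) * bform e (coeff h)"
    using e(2) degree_lin_mult[OF degree_lin_le, of P P]
    by (intro bform_mult) (auto simp: power2_eq_square)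
  also have "bform 2 (coeff (lin P ^ 2)) = ?L ^ 2"
    using bform_mult[OF degree_lin_le degree_lin_le, of P P]
    by (simp add: power2_eq_square numeral_2_eq_2)
  finally have "?L ^ 2 dvd bform s (coeff g)" by simp
  thus "\<exists>P. is_multiple_root (bform s (coeff g)) P"
    using P(1) unfolding is_multiple_root_def homogeneous_coords_def linear_form_lin by blast
qed

section \<open>Spreading the roots of an annihilator\<close>

lemma annihilates_cong:
  assumes "annihilates d Z s g" "\<And>j. j \<le> d \<Longrightarrow> Z j = Y j"
  shows "annihilates d Y s g"
  unfolding annihilates_def
proof safe
  show "degree g \<le> s" using assms(1) by (rule annihilates_degree)
  fix h :: "'a poly" assume h: "degree h + s \<le> d"
  have "degree (g * h) \<le> d" using degree_mult_le[of g h] annihilates_degree[OF assms(1)] h by linarith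
  hence "apol Y (g * h) = apol Z (g * h)" using assms(2) by (intro apol_cong) auto
  thus "apol Y (g * h) = 0" using annihilatesD[OF assms(1) h] by simp
qed

text \<open>
  A contraction that varies polynomially in a parameter lifts to a polynomial family through the given
  sequence. If \<open>L = b x - a y\<close> and \<open>M = m0 x + m1 y\<close> with \<open>m0 a + m1 b = 1\<close>, then
  \<open>x = a M + m1 L\<close> and \<open>y = b M - m0 L\<close>. The contraction of the unknown \<open>W\<close> by \<open>L\<close> is prescribed as
  \<open>W'\<close>; its contraction by \<open>M\<close> is found by induction as \<open>V\<close>, and both together determine \<open>W\<close>.
\<close>

lemma lift_contraction:
  fixes a b :: "'a::field poly"
  assumes m: "Polynomial.smult m0 a + Polynomial.smult m1 b = 1"
    and "\<And>j. j < d \<Longrightarrow> poly (W' j) 0 = poly b 0 * Z j - poly a 0 * Z (Suc j)"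
  shows "\<exists>W. (\<forall>j<d. b * W j - a * W (Suc j) = W' j) \<and> (\<forall>j\<le>d. poly (W j) 0 = Z j)"
  using assms(2)
proof (induction d arbitrary: W' Z)
  case 0
  show ?case by (intro exI[of _ "\<lambda>j. [:Z j:]"]) simp
next
  case (Suc d)
  define U where "U j = Polynomial.smult m0 (W' j) + Polynomial.smult m1 (W' (Suc j))" for j
  have "poly (U j) 0 = poly b 0 * (m0 * Z j + m1 * Z (Suc j)) - poly a 0 * (m0 * Z (Suc j) + m1 * Z (Suc (Suc j)))"
    if "j < d" for j
    using Suc.prems[of j] Suc.prems[of "Suc j"] that by (simp add: U_def) (simp add: algebra_simps)
  then obtain V where V: "\<And>j. j < d \<Longrightarrow> b * V j - a * V (Suc j) = U j"
      "\<And>j. j \<le> d \<Longrightarrow> poly (V j) 0 = m0 * Z j + m1 * Z (Suc j)"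
    using Suc.IH[of U "\<lambda>j. m0 * Z j + m1 * Z (Suc j)"] by blast
  define W where "W j = (if j \<le> d then a * V j + Polynomial.smult m1 (W' j)
      else b * V d - Polynomial.smult m0 (W' d))" for j
  have W_Suc: "W (Suc j) = b * V j - Polynomial.smult m0 (W' j)" if "j \<le> d" for j
  proof (cases "j = d")
    case False
    hence "b * V j - a * V (Suc j) = U j" using V(1) that by simp
    thus ?thesis using that False by (simp add: W_def U_def algebra_simps)
  qed (simp add: W_def)
  have m': "m0 * poly a 0 + m1 * poly b 0 = 1" using arg_cong[OF m, of "\<lambda>p. poly p 0"] by simp
  have "b * W j - a * W (Suc j) = W' j" if "j < Suc d" for j
  proof -
    have Wj: "W j = a * V j + Polynomial.smult m1 (W' j)" using that by (simp add: W_def)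
    have "b * W j - a * W (Suc j) = (Polynomial.smult m0 a + Polynomial.smult m1 b) * W' j"
      using that unfolding Wj by (simp add: W_Suc algebra_simps)
    thus ?thesis using m by simp
  qed
  moreover have "poly (W j) 0 = Z j" if "j \<le> Suc d" for j
  proof (cases "j \<le> d")
    case True
    have "poly (W j) 0 = (m0 * poly a 0 + m1 * poly b 0) * Z j"
      using True V(2)[OF True] Suc.prems[of j] by (simp add: W_def) (simp add: algebra_simps)
    thus ?thesis using m' by simp
  next
    case False
    hence "j = Suc d" using that by simp
    hence "poly (W j) 0 = (m0 * poly a 0 + m1 * poly b 0) * Z j"
      using V(2)[of d] Suc.prems[of d] by (simp add: W_def) (simp add: algebra_simps)
    thus ?thesis using m' by simp
  qed
  ultimately show ?case by blast
qed

text \<open>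
  The points \<open>P i + \<tau> i m\<close>. Moving along \<open>m\<close> leaves the values of the linear form \<open>lin m\<close> at the
  points unchanged, so that the lift stays polynomial in \<open>\<tau>\<close>; the different speeds \<open>i\<close> separate
  coinciding points.
\<close>

definition spread :: "'a::field \<times> 'a \<Rightarrow> (nat \<Rightarrow> 'a \<times> 'a) \<Rightarrow> 'a \<Rightarrow> nat \<Rightarrow> 'a \<times> 'a" where
  "spread m P \<tau> i = (fst (P i) + \<tau> * (of_nat i * fst m), snd (P i) + \<tau> * (of_nat i * snd m))"

text \<open>
  Any functional annihilated by a product of linear forms deforms along with the roots of the product:
  contract by the last factor, deform by induction, lift.
\<close>

lemma annihilated_family:
  fixes Z :: "nat \<Rightarrow> 'a::field"
  assumes "\<And>i. i < r \<Longrightarrow> snd m * fst (P i) - fst m * snd (P i) = 1"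
    and "annihilates d Z r (\<Prod>i<r. lin (P i))"
  shows "\<exists>W. (\<forall>j\<le>d. poly (W j) 0 = Z j) \<and>
    (\<forall>\<tau>. annihilates d (\<lambda>j. poly (W j) \<tau>) r (\<Prod>i<r. lin (spread m P \<tau> i)))"
  using assms
proof (induction r arbitrary: d Z)
  case 0
  have "Z j = 0" if "j \<le> d" for j
    using annihilatesD[OF 0(2), of "Polynomial.monom 1 j"] that by (simp add: apol_monom degree_monom_eq)
  thus ?case
    by (intro exI[of _ "\<lambda>_. 0"]) (auto simp: annihilates_def apol_def)
next
  case (Suc r)
  show ?case
  proof (cases d)
    case 0
    have "annihilates d Y (Suc r) (\<Prod>i<Suc r. lin (Q i))" for Y :: "nat \<Rightarrow> 'a" and Q
      using 0 degree_prod_lin[of Q "Suc r"] by (simp add: annihilates_def del: prod.lessThan_Suc)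
    thus ?thesis by (intro exI[of _ "\<lambda>j. [:Z j:]"]) auto
  next
    case (Suc d')
    have "annihilates d' (contract (P r) Z) r (\<Prod>i<r. lin (P i))"
      using Suc.prems(2) Suc
      by (intro annihilates_contract_lin[OF _ degree_prod_lin]) (simp add: mult.commute)
    then obtain W' where W': "\<And>j. j \<le> d' \<Longrightarrow> poly (W' j) 0 = contract (P r) Z j"
        "\<And>\<tau>. annihilates d' (\<lambda>j. poly (W' j) \<tau>) r (\<Prod>i<r. lin (spread m P \<tau> i))"
      using Suc.IH[of d' "contract (P r) Z"] Suc.prems(1) by auto
    let ?a = "[:fst (P r), of_nat r * fst m:]" and ?b = "[:snd (P r), of_nat r * snd m:]"
    have m: "Polynomial.smult (snd m) ?a + Polynomial.smult (- fst m) ?b = 1"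
      using Suc.prems(1)[of r] by (simp add: one_pCons)
    have "poly (W' j) 0 = poly ?b 0 * Z j - poly ?a 0 * Z (Suc j)" if "j < d" for j
      using W'(1)[of j] that Suc by (simp add: contract_def)
    then obtain W where W: "\<And>j. j < d \<Longrightarrow> ?b * W j - ?a * W (Suc j) = W' j"
        "\<And>j. j \<le> d \<Longrightarrow> poly (W j) 0 = Z j"
      using lift_contraction[OF m, of d W' Z] by blast
    have "annihilates d (\<lambda>j. poly (W j) \<tau>) (Suc r) (\<Prod>i<Suc r. lin (spread m P \<tau> i))" for \<tau>
    proof -
      have "poly (W' j) \<tau> = contract (spread m P \<tau> r) (\<lambda>j. poly (W j) \<tau>) j" if "j \<le> d'" for j
        using W(1)[of j, symmetric] that Suc by (simp add: contract_def spread_def) (simp add: algebra_simps)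
      hence "annihilates d' (contract (spread m P \<tau> r) (\<lambda>j. poly (W j) \<tau>)) r (\<Prod>i<r. lin (spread m P \<tau> i))"
        by (rule annihilates_cong[OF W'(2)])
      from annihilates_lin_contract[OF this] show ?thesis using Suc by (simp add: mult.commute)
    qed
    thus ?thesis using W(2) by blast
  qed
qed

lemma spread_independent:
  fixes m :: "'a::field_char_0 \<times> 'a"
  assumes m: "\<And>i. i < r \<Longrightarrow> snd m * fst (P i) - fst m * snd (P i) = 1"
  shows "finite {\<tau>. \<not> independent_points r (spread m P \<tau>)}"
proof (rule finite_subset)
  define D where "D i j = snd (P i) * fst (P j) - fst (P i) * snd (P j)" for i j
  let ?bad = "(\<lambda>(i, j). - D i j / (of_nat i - of_nat j)) ` ({..<r} \<times> {..<r})"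
  show "finite ?bad" by simp
  show "{\<tau>. \<not> independent_points r (spread m P \<tau>)} \<subseteq> ?bad"
  proof
    fix \<tau> assume "\<tau> \<in> {\<tau>. \<not> independent_points r (spread m P \<tau>)}"
    hence "\<not> independent_points r (spread m P \<tau>)" by simp
    moreover have "spread m P \<tau> i \<noteq> (0, 0)" if "i < r" for i
    proof
      assume "spread m P \<tau> i = (0, 0)"
      hence "snd m * (fst (P i) + \<tau> * (of_nat i * fst m)) - fst m * (snd (P i) + \<tau> * (of_nat i * snd m)) = 0"
        by (simp add: spread_def)
      thus False using m[OF that] by (simp add: algebra_simps)
    qed
    ultimately obtain i j where ij: "i < r" "j < r" "i \<noteq> j"
        "snd (spread m P \<tau> i) * fst (spread m P \<tau> j) = fst (spread m P \<tau> i) * snd (spread m P \<tau> j)"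
      unfolding independent_points_def by blast
    \<comment> \<open>Affine in \<open>\<tau>\<close>: the quadratic terms cancel as both points move along \<open>m\<close>.\<close>
    have "snd (spread m P \<tau> i) * fst (spread m P \<tau> j) - fst (spread m P \<tau> i) * snd (spread m P \<tau> j)
        = D i j + \<tau> * (of_nat i * (snd m * fst (P j) - fst m * snd (P j))
            - of_nat j * (snd m * fst (P i) - fst m * snd (P i)))"
      by (simp add: spread_def D_def algebra_simps)
    hence "D i j + \<tau> * (of_nat i - of_nat j) = 0" using ij m by simp
    moreover have "of_nat i - of_nat j \<noteq> (0::'a)" using ij(3) by simp
    ultimately have "\<tau> = - D i j / (of_nat i - of_nat j)" by (simp add: field_simps eq_neg_iff_add_eq_0)
    thus "\<tau> \<in> ?bad" using ij(1,2) by force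
  qed
qed

section \<open>The Zariski closure of the forms of given rank\<close>

lemma in_zariski_closureI:
  assumes "q \<in> binary_forms d"
    and "\<And>\<phi>. polynomial_fun d \<phi> \<Longrightarrow> (\<And>p. p \<in> A \<Longrightarrow> \<phi> p = 0) \<Longrightarrow> \<phi> q = 0"
  shows "q \<in> zariski_closure d A"
  unfolding zariski_closure_def hull_def
proof (rule InterI)
  fix T assume "T \<in> {t. zariski_closed d t \<and> A \<subseteq> t}"
  then obtain \<Phi> where "\<forall>\<phi>\<in>\<Phi>. polynomial_fun d \<phi>" "T = {q \<in> binary_forms d. \<forall>\<phi>\<in>\<Phi>. \<phi> q = 0}" "A \<subseteq> T"
    unfolding zariski_closed_def by blast
  moreover from this have "\<phi> q = 0" if "\<phi> \<in> \<Phi>" for \<phi> using assms(2)[of \<phi>] that by blast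
  ultimately show "q \<in> T" using assms(1) by blast
qed

lemma notin_zariski_closureI:
  assumes "polynomial_fun d \<phi>" "\<And>p. p \<in> A \<Longrightarrow> \<phi> p = 0" "A \<subseteq> binary_forms d" "\<phi> q \<noteq> 0"
  shows "q \<notin> zariski_closure d A"
proof
  assume q: "q \<in> zariski_closure d A"
  let ?T = "{q \<in> binary_forms d. \<forall>\<psi>\<in>{\<phi>}. \<psi> q = 0}"
  have "zariski_closed d ?T" unfolding zariski_closed_def using assms(1) by blast
  moreover have "A \<subseteq> ?T" using assms(2,3) by auto
  ultimately have "q \<in> ?T" using q unfolding zariski_closure_def hull_def by blast
  thus False using assms(4) by simp
qed

lemma polynomial_fun_curve:
  assumes "polynomial_fun d \<phi>"
  shows "\<exists>p. \<forall>\<tau>. \<phi> (form_of d (\<lambda>j. poly (W j) \<tau>)) = poly p \<tau>"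
  using assms
proof (induction rule: polynomial_fun.induct)
  case (const_fun c)
  show ?case by (intro exI[of _ "[:c:]"]) simp
next
  case (coordinate j)
  thus ?case
    by (intro exI[of _ "Polynomial.smult (of_nat (d choose j)) (W j)"]) (simp add: form_of_def coeff_bform)
next
  case (add \<phi> \<psi>)
  then obtain p p' where "\<And>\<tau>. \<phi> (form_of d (\<lambda>j. poly (W j) \<tau>)) = poly p \<tau>"
    "\<And>\<tau>. \<psi> (form_of d (\<lambda>j. poly (W j) \<tau>)) = poly p' \<tau>" by blast
  thus ?case by (intro exI[of _ "p + p'"]) simp
next
  case (mult \<phi> \<psi>)
  then obtain p p' where "\<And>\<tau>. \<phi> (form_of d (\<lambda>j. poly (W j) \<tau>)) = poly p \<tau>"
    "\<And>\<tau>. \<psi> (form_of d (\<lambda>j. poly (W j) \<tau>)) = poly p' \<tau>" by blast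
  thus ?case by (intro exI[of _ "p * p'"]) simp
qed

text \<open>
  The determinant of the dual system: its matrix is the identity at \<open>Z\<close> and singular at every
  sequence of rank below \<open>a\<close>.
\<close>

lemma rank_detector:
  fixes Z :: "nat \<Rightarrow> 'a::field_char_0"
  assumes min: "minimal_annihilator d Z a f" and a: "1 \<le> a" "a \<le> Suc d"
  obtains \<phi> where "polynomial_fun d \<phi>" "\<phi> (form_of d Z) \<noteq> 0"
    "\<And>Y s. s < a \<Longrightarrow> power_sum d Y s \<Longrightarrow> \<phi> (form_of d Y) = 0"
proof -
  obtain a' where a': "a = Suc a'" "a' \<le> d" using a by (cases a) auto
  obtain B where B: "\<And>j l. j \<le> a' \<Longrightarrow> l \<le> a' \<Longrightarrow>
      (\<Sum>i\<le>d - a'. B j i * Z (l + i)) = (if j = l then 1 else 0)"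
    using dual_system[of d Z a' f] min a' by blast
  define \<zeta> :: "'a poly poly \<Rightarrow> nat \<Rightarrow> 'a" where "\<zeta> q j = inverse (of_nat (d choose j)) * coeff (coeff q j) (d - j)" for q j
  have \<zeta>: "\<zeta> (form_of d Y) j = Y j" if "j \<le> d" for Y :: "nat \<Rightarrow> 'a" and j
    using that by (simp add: \<zeta>_def form_of_def coeff_bform)
  have eq: "minor_mat B d a' (\<zeta> (form_of d Y)) = minor_mat B d a' Y" for Y :: "nat \<Rightarrow> 'a"
    unfolding minor_mat_def using a' by (intro eq_matI) (auto intro!: sum.cong simp: \<zeta>)
  show ?thesis
  proof (rule that[of "\<lambda>q. det (minor_mat B d a' (\<zeta> q))"])
    show "polynomial_fun d (\<lambda>q. det (minor_mat B d a' (\<zeta> q)))"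
      unfolding \<zeta>_def by (intro polynomial_fun_det_minor_mat a' polynomial_fun.intros)
    show "det (minor_mat B d a' (\<zeta> (form_of d Z))) \<noteq> 0"
      unfolding eq using det_minor_mat_dual[where a = a' and d = d and B = B and Z = Z] B by simp
    fix Y :: "nat \<Rightarrow> 'a" and s assume "s < a" "power_sum d Y s"
    thus "det (minor_mat B d a' (\<zeta> (form_of d Y))) = 0"
      unfolding eq using det_minor_mat_power_sum[of d Y s a' B] a' by simp
  qed
qed

lemma form_rank_eqI:
  fixes Z :: "nat \<Rightarrow> 'a::field_char_0"
  assumes "1 \<le> r" "power_sum d Z r" "\<And>s. power_sum d Z s \<Longrightarrow> r \<le> s"
  shows "form_rank d (form_of d Z) = r"
  unfolding form_rank_def power_sum_iff[symmetric] using assms by (intro Least_equality) auto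

lemma power_sum_exists:
  fixes Z :: "nat \<Rightarrow> 'a::{alg_closed_field, field_char_0}"
  assumes "1 \<le> d"
  shows "power_sum d Z (Suc d)"
proof -
  let ?P = "\<lambda>i. (1 :: 'a, of_nat i)"
  have "independent_points (Suc d) ?P" by (auto simp: independent_points_def)
  moreover have "annihilates d Z (Suc d) (\<Prod>i<Suc d. lin (?P i))"
    using degree_prod_lin[of ?P "Suc d"] by (simp add: annihilates_def del: prod.lessThan_Suc)
  ultimately obtain c where "\<forall>j\<le>d. Z j = (\<Sum>i<Suc d. c i * power_seq d (?P i) j)"
    using apolarity[of "Suc d" ?P d Z] by blast
  thus ?thesis by (intro power_sumI[OF assms, where c = c and P = ?P]) blast
qed

lemma binary_form_form_of:
  fixes p :: "'a::field_char_0 poly poly"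
  assumes "p \<in> binary_forms d"
  obtains Z where "p = form_of d Z"
proof
  show "p = form_of d (\<lambda>j. coeff (coeff p j) (d - j) / of_nat (d choose j))"
    unfolding form_of_def
    by (subst binary_form_eq_bform[OF assms]) (auto intro!: bform_cong)
qed

lemma power_sum_form_rank:
  fixes Z :: "nat \<Rightarrow> 'a::{alg_closed_field, field_char_0}"
  assumes "1 \<le> d"
  shows "power_sum d Z (form_rank d (form_of d Z))"
proof -
  have "1 \<le> Suc d \<and> power_sum d Z (Suc d)" using power_sum_exists[OF assms] by simp
  from LeastI[of "\<lambda>r. 1 \<le> r \<and> power_sum d Z r", OF this]
  show ?thesis unfolding form_rank_def power_sum_iff[symmetric] by simp
qed

text \<open>
  The family through \<open>Z\<close> in which the roots of the minimal annihilator are spread apart has rank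
  exactly \<open>a\<close> for all but finitely many parameters: at most \<open>a\<close> by apolarity, at least \<open>a\<close> by the
  detector. A polynomial function vanishing on forms of rank \<open>a\<close> restricts to a polynomial in the
  parameter with infinitely many zeros, hence vanishes at \<open>Z\<close>.
\<close>

lemma in_closure_forms_of_rank:
  fixes Z :: "nat \<Rightarrow> 'a::{alg_closed_field, field_char_0}"
  assumes min: "minimal_annihilator d Z a f" and a: "1 \<le> a" "a \<le> Suc d" and d: "1 \<le> d"
  shows "form_of d Z \<in> zariski_closure d (forms_of_rank d a)"
proof -
  have f: "f \<noteq> 0" "annihilates d Z a f" using min by (auto simp: minimal_annihilator_def)
  obtain P0 c where P0: "c \<noteq> 0" "\<forall>i<a. P0 i \<noteq> (0, 0)" "f = Polynomial.smult c (\<Prod>i<a. lin (P0 i))"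
    using form_splits[OF f(1) annihilates_degree[OF f(2)]] by blast
  obtain z where z: "z \<notin> (\<lambda>i. snd (P0 i) / fst (P0 i)) ` {..<a}"
    using ex_new_if_finite[OF infinite_UNIV_char_0] by (metis finite_imageI finite_lessThan)
  define m where "m = (1 :: 'a, z)"
  define \<mu> where "\<mu> i = z * fst (P0 i) - snd (P0 i)" for i
  have \<mu>: "\<mu> i \<noteq> 0" if "i < a" for i
  proof
    assume "\<mu> i = 0"
    hence eq: "snd (P0 i) = z * fst (P0 i)" by (simp add: \<mu>_def)
    hence "fst (P0 i) \<noteq> 0" using P0(2) that by (auto simp: prod_eq_iff)
    hence "z = snd (P0 i) / fst (P0 i)" using eq by simp
    thus False using z that by blast
  qed
  define P where "P i = (fst (P0 i) / \<mu> i, snd (P0 i) / \<mu> i)" for i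
  have Pm: "snd m * fst (P i) - fst m * snd (P i) = 1" if "i < a" for i
    using \<mu>[OF that] by (simp add: P_def m_def \<mu>_def diff_divide_distrib[symmetric])
  have "(\<Prod>i<a. lin (P i)) = (\<Prod>i<a. Polynomial.smult (1 / \<mu> i) (lin (P0 i)))"
    by (intro prod.cong refl lin_scale) (simp_all add: P_def)
  also have "\<dots> = Polynomial.smult (\<Prod>i<a. 1 / \<mu> i) (\<Prod>i<a. lin (P0 i))" by (rule prod_smult)
  also have "\<dots> = Polynomial.smult ((\<Prod>i<a. 1 / \<mu> i) / c) f" using P0 by simp
  finally have "annihilates d Z a (\<Prod>i<a. lin (P i))" using annihilates_smult[OF f(2)] by simp
  then obtain W where W: "\<And>j. j \<le> d \<Longrightarrow> poly (W j) 0 = Z j"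
      "\<And>\<tau>. annihilates d (\<lambda>j. poly (W j) \<tau>) a (\<Prod>i<a. lin (spread m P \<tau> i))"
    using annihilated_family[of a m P d Z] Pm by blast
  have W0: "form_of d (\<lambda>j. poly (W j) 0) = form_of d Z" using W(1) by (simp add: form_of_eq_iff)
  obtain \<phi> where \<phi>: "polynomial_fun d \<phi>" "\<phi> (form_of d Z) \<noteq> 0"
      "\<And>Y s. s < a \<Longrightarrow> power_sum d Y s \<Longrightarrow> \<phi> (form_of d Y) = 0"
    using rank_detector[OF min a] by blast
  obtain p where p: "\<And>\<tau>. \<phi> (form_of d (\<lambda>j. poly (W j) \<tau>)) = poly p \<tau>"
    using polynomial_fun_curve[OF \<phi>(1)] by blast
  have "p \<noteq> 0" using p[of 0] \<phi>(2) W0 by auto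
  define bad where "bad = {\<tau>. poly p \<tau> = 0} \<union> {\<tau>. \<not> independent_points a (spread m P \<tau>)}"
  have bad: "finite bad"
    using poly_roots_finite[OF \<open>p \<noteq> 0\<close>] spread_independent[of a m P] Pm by (simp add: bad_def)
  have rank: "form_of d (\<lambda>j. poly (W j) \<tau>) \<in> forms_of_rank d a" if "\<tau> \<notin> bad" for \<tau>
  proof -
    have "form_rank d (form_of d (\<lambda>j. poly (W j) \<tau>)) = a"
    proof (rule form_rank_eqI[OF a(1)])
      have "independent_points a (spread m P \<tau>)" using that by (simp add: bad_def)
      then obtain c where "\<forall>j\<le>d. poly (W j) \<tau> = (\<Sum>i<a. c i * power_seq d (spread m P \<tau> i) j)"
        using apolarity[OF _ W(2)] by blast
      thus "power_sum d (\<lambda>j. poly (W j) \<tau>) a" by (intro power_sumI[OF d, where c = c and P = "spread m P \<tau>"]) blast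
    next
      fix s assume "power_sum d (\<lambda>j. poly (W j) \<tau>) s"
      thus "a \<le> s" using \<phi>(3) p that by (metis (mono_tags, lifting) UnCI bad_def mem_Collect_eq not_le)
    qed
    thus ?thesis by (simp add: forms_of_rank_def form_of_def bform_mem)
  qed
  show ?thesis
  proof (rule in_zariski_closureI)
    show "form_of d Z \<in> binary_forms d" by (simp add: form_of_def bform_mem)
    fix \<psi> :: "'a poly poly \<Rightarrow> 'a"
    assume \<psi>: "polynomial_fun d \<psi>" "\<And>p. p \<in> forms_of_rank d a \<Longrightarrow> \<psi> p = 0"
    obtain p' where p': "\<And>\<tau>. \<psi> (form_of d (\<lambda>j. poly (W j) \<tau>)) = poly p' \<tau>"
      using polynomial_fun_curve[OF \<psi>(1)] by blast
    have "- bad \<subseteq> {\<tau>. poly p' \<tau> = 0}" using rank \<psi>(2) p' by fastforce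
    moreover have "infinite (- bad)" using bad infinite_UNIV_char_0 by (metis finite_compl)
    ultimately have "p' = 0" using poly_roots_finite finite_subset by blast
    thus "\<psi> (form_of d Z) = 0" using p'[of 0] W0 by simp
  qed
qed

lemma form_roots_factor:
  fixes g :: "'a::field poly"
  assumes "degree g \<le> s" "r \<le> s" "independent_points r P" "\<And>i. i < r \<Longrightarrow> form_eval s g (P i) = 0"
  shows "\<exists>h. degree h + r \<le> s \<and> g = (\<Prod>i<r. lin (P i)) * h"
  using assms(2-4)
proof (induction r)
  case 0
  thus ?case using assms(1) by auto
next
  case (Suc r)
  have "independent_points r P" using Suc.prems(2) by (auto simp: independent_points_def)
  then obtain h where h: "degree h + r \<le> s" "g = (\<Prod>i<r. lin (P i)) * h"
    using Suc.IH Suc.prems by auto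
  obtain t where t: "s = r + Suc t" using Suc.prems(1) by (metis Suc_le_D add_Suc_right add_Suc le_iff_add)
  have "form_eval s g (P r) = form_eval r (\<Prod>i<r. lin (P i)) (P r) * form_eval (Suc t) h (P r)"
    unfolding h(2) t using h(1) t by (intro form_eval_mult degree_prod_lin) simp
  moreover have "form_eval r (\<Prod>i<r. lin (P i)) (P r) \<noteq> 0"
    using Suc.prems(2) by (auto simp: form_eval_prod_lin independent_points_def)
  ultimately have "form_eval (Suc t) h (P r) = 0" using Suc.prems(3)[of r] by simp
  moreover have "P r \<noteq> (0, 0)" using Suc.prems(2) by (simp add: independent_points_def)
  ultimately obtain h' where h': "degree h' \<le> t" "h = lin (P r) * h'"
    using form_root_factor[of h t "P r"] h(1) t by auto
  thus ?case using h t by (intro exI[of _ h']) (simp add: mult.assoc)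
qed

section \<open>Rank and closure\<close>

theorem mainTheorem3:
  fixes Z :: "nat \<Rightarrow> 'a::{alg_closed_field, field_char_0}"
    and d n k :: nat
    and q :: "'a poly poly"
    and N M :: "'a mat"
  assumes "d \<ge> 1"
    and "n = d div 2"
    and "q = (\<Sum>i\<le>d. const (of_nat (d choose i) * Z i) * var_x ^ (d - i) * var_y ^ i)"
    and "q \<noteq> 0"
    and "N = hankel_mat Z (d - n + 1) (n + 1)"
    and "k + 1 = mat_rank N"
    and "M = hankel_mat Z (d - k) (k + 2)"
  shows "q \<in> zariski_closure d (forms_of_rank d (k + 1)) - zariski_closure d (forms_of_rank d k)
    \<and> (d = 2 * n \<and> k = n \<longrightarrow> form_rank d q = k + 1 \<and> k + 1 = d - k + 1)
    \<and> (\<not> (d = 2 * n \<and> k = n) \<longrightarrow>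
        mat_rank M = k + 1
        \<and> (\<exists>v \<in> carrier_vec (k + 2). v \<noteq> 0\<^sub>v (k + 2) \<and> M *\<^sub>v v = 0\<^sub>v (d - k)
             \<and> (\<forall>w \<in> carrier_vec (k + 2). M *\<^sub>v w = 0\<^sub>v (d - k) \<longrightarrow> (\<exists>c. w = c \<cdot>\<^sub>v v)))
        \<and> (\<forall>v \<in> carrier_vec (k + 2). \<forall>f.
             v \<noteq> 0\<^sub>v (k + 2) \<and> M *\<^sub>v v = 0\<^sub>v (d - k)
             \<and> f = (\<Sum>i\<le>k + 1. const (v $ i) * var_x ^ (k + 1 - i) * var_y ^ i) \<longrightarrow>
               ((\<nexists>P. is_multiple_root f P) \<longrightarrow> form_rank d q = k + 1)
             \<and> ((\<exists>P. is_multiple_root f P) \<longrightarrow> form_rank d q = d - k + 1)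
             \<and> (\<forall>t u :: nat \<Rightarrow> 'a.
                  (\<forall>i \<in> {1..k + 1}. is_root f (t i, u i))
                  \<and> (\<forall>i \<in> {1..k + 1}. \<forall>j \<in> {1..k + 1}.
                       i \<noteq> j \<longrightarrow> \<not> same_point (t i, u i) (t j, u j)) \<longrightarrow>
                  (\<exists>c :: nat \<Rightarrow> 'a.
                     q = (\<Sum>i = 1..k + 1.
                            const (c i) * (const (t i) * var_x + const (u i) * var_y) ^ d)))))"
proof -
  have d: "1 \<le> d" and n: "n = d div 2" using assms by auto
  have q: "q = form_of d Z" using assms(3) by (simp add: form_of_def bform_def)
  have "\<exists>j\<le>d. Z j \<noteq> 0"
  proof (rule ccontr)
    assume "\<not> (\<exists>j\<le>d. Z j \<noteq> 0)"
    hence "q = 0" unfolding q form_of_def bform_monom by simp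
    thus False using assms(4) by simp
  qed
  then obtain a f where min: "minimal_annihilator d Z a f" and a: "1 \<le> a" "2 * a \<le> d + 2"
    using minimal_annihilator_exists[of _ d Z] by metis
  have an: "a \<le> Suc n" "n \<le> d" "a + n \<le> Suc d" "Suc n \<le> d" using a n d by linarith+
  have "mat_rank N = a"
    using rank_hankel[OF min an(2,1,3)] assms(5) by simp
  hence ak: "a = Suc k" using assms(6) by simp
  have ad: "a \<le> Suc d" using an by simp
  obtain \<phi> where \<phi>: "polynomial_fun d \<phi>" "\<phi> (form_of d Z) \<noteq> 0"
      "\<And>Y s. s < a \<Longrightarrow> power_sum d Y s \<Longrightarrow> \<phi> (form_of d Y) = 0"
    using rank_detector[OF min a(1) ad] by blast
  have lower: "a \<le> s" if "power_sum d Z s" for s using \<phi>(2,3) that by (metis not_le)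
  have upper: "power_sum d Z (d + 2 - a)" by (rule power_sum_upper_bound[OF min a d])

  have "q \<in> zariski_closure d (forms_of_rank d (k + 1))"
    using in_closure_forms_of_rank[OF min a(1) ad d] q ak by simp
  moreover have "q \<notin> zariski_closure d (forms_of_rank d k)"
  proof (rule notin_zariski_closureI[OF \<phi>(1)])
    fix p :: "'a poly poly" assume p: "p \<in> forms_of_rank d k"
    then obtain Y where Y: "p = form_of d Y"
      using binary_form_form_of[of p d] by (auto simp: forms_of_rank_def)
    have "power_sum d Y k" using power_sum_form_rank[OF d, of Y] p Y by (simp add: forms_of_rank_def)
    thus "\<phi> p = 0" using \<phi>(3)[of k Y] Y ak by simp
  qed (use \<phi>(2) q in \<open>auto simp: forms_of_rank_def\<close>)
  ultimately have part_i: "q \<in> zariski_closure d (forms_of_rank d (k + 1)) - zariski_closure d (forms_of_rank d k)"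
    by blast

  have part_ii: "form_rank d q = k + 1 \<and> k + 1 = d - k + 1" if "d = 2 * n \<and> k = n"
  proof -
    have "d + 2 - a = a" using that ak by simp
    hence "form_rank d q = a" unfolding q using upper lower a(1) by (intro form_rank_eqI) auto
    thus ?thesis using that ak by simp
  qed

  have part_iii: "mat_rank M = k + 1
        \<and> (\<exists>v \<in> carrier_vec (k + 2). v \<noteq> 0\<^sub>v (k + 2) \<and> M *\<^sub>v v = 0\<^sub>v (d - k)
             \<and> (\<forall>w \<in> carrier_vec (k + 2). M *\<^sub>v w = 0\<^sub>v (d - k) \<longrightarrow> (\<exists>c. w = c \<cdot>\<^sub>v v)))
        \<and> (\<forall>v \<in> carrier_vec (k + 2). \<forall>f.
             v \<noteq> 0\<^sub>v (k + 2) \<and> M *\<^sub>v v = 0\<^sub>v (d - k)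
             \<and> f = (\<Sum>i\<le>k + 1. const (v $ i) * var_x ^ (k + 1 - i) * var_y ^ i) \<longrightarrow>
               ((\<nexists>P. is_multiple_root f P) \<longrightarrow> form_rank d q = k + 1)
             \<and> ((\<exists>P. is_multiple_root f P) \<longrightarrow> form_rank d q = d - k + 1)
             \<and> (\<forall>t u :: nat \<Rightarrow> 'a.
                  (\<forall>i \<in> {1..k + 1}. is_root f (t i, u i))
                  \<and> (\<forall>i \<in> {1..k + 1}. \<forall>j \<in> {1..k + 1}.
                       i \<noteq> j \<longrightarrow> \<not> same_point (t i, u i) (t j, u j)) \<longrightarrow>
                  (\<exists>c :: nat \<Rightarrow> 'a.
                     q = (\<Sum>i = 1..k + 1.
                            const (c i) * (const (t i) * var_x + const (u i) * var_y) ^ d))))"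
    if "\<not> (d = 2 * n \<and> k = n)"
  proof -
    \<comment> \<open>This inequality fails exactly in the excluded case, where there are two generators of equal degree.\<close>
    have a2: "a + a \<le> Suc d" using that an ak n by linarith
    have ad': "a \<le> d" using an by simp
    have dk: "Suc (d - a) = d - k" using ak ad' by simp
    have sa: "Suc a = k + 2" using ak by simp
    have M: "M = hankel_mat Z (Suc (d - a)) (Suc a)" using assms(7) dk sa by simp
    have ker: "M *\<^sub>v v = 0\<^sub>v (d - k) \<longleftrightarrow> annihilates d Z a (poly_of_coeffs v)"
      if "v \<in> carrier_vec (k + 2)" for v
      using hankel_kernel[OF ad', of v Z] that M dk sa by simp
    have rank: "mat_rank M = k + 1"
      using rank_hankel[OF min ad' _ a2] M ak by simp

    have f: "annihilates d Z a f" "f \<noteq> 0" using min by (auto simp: minimal_annihilator_def)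
    let ?v = "vec (Suc a) (coeff f)"
    have vc: "?v \<in> carrier_vec (k + 2)" using sa by simp
    have vf: "poly_of_coeffs ?v = f" by (rule poly_of_coeffs_vec[OF annihilates_degree[OF f(1)]])
    have "?v \<noteq> 0\<^sub>v (k + 2)" using vf f(2) poly_of_coeffs_eq_0_iff[OF vc] by metis
    moreover have "M *\<^sub>v ?v = 0\<^sub>v (d - k)" using ker[OF vc] vf f(1) by simp
    moreover have "\<exists>c. w = c \<cdot>\<^sub>v ?v" if w: "w \<in> carrier_vec (k + 2)" "M *\<^sub>v w = 0\<^sub>v (d - k)" for w
    proof -
      have "form_dvd a f a (poly_of_coeffs w)"
        using minimal_annihilator_form_dvd[OF min _ a2] ker[OF w(1)] w(2) by blast
      then obtain c where c: "poly_of_coeffs w = Polynomial.smult c f"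
        unfolding form_dvd_def
      proof (elim disjE exE conjE)
        fix h assume h: "degree h + a \<le> a" "poly_of_coeffs w = f * h"
        then obtain b where "h = [:b:]" using degree0_coeffs by auto
        thus ?thesis using that[of b] h by simp
      qed (use that[of 0] in simp)
      have "w = c \<cdot>\<^sub>v ?v"
      proof (rule eq_vecI)
        fix i assume "i < dim_vec (c \<cdot>\<^sub>v ?v)"
        hence "i < Suc a" by simp
        thus "w $ i = (c \<cdot>\<^sub>v ?v) $ i"
          using arg_cong[OF c, of "\<lambda>p. coeff p i"] w(1) sa by (simp add: coeff_poly_of_coeffs)
      qed (use w(1) sa in simp)
      thus ?thesis by blast
    qed
    ultimately have kernel: "\<exists>v \<in> carrier_vec (k + 2). v \<noteq> 0\<^sub>v (k + 2) \<and> M *\<^sub>v v = 0\<^sub>v (d - k)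
             \<and> (\<forall>w \<in> carrier_vec (k + 2). M *\<^sub>v w = 0\<^sub>v (d - k) \<longrightarrow> (\<exists>c. w = c \<cdot>\<^sub>v v))"
      using vc by blast

    have forms: "((\<nexists>P. is_multiple_root F P) \<longrightarrow> form_rank d q = k + 1)
             \<and> ((\<exists>P. is_multiple_root F P) \<longrightarrow> form_rank d q = d - k + 1)
             \<and> (\<forall>t u :: nat \<Rightarrow> 'a.
                  (\<forall>i \<in> {1..k + 1}. is_root F (t i, u i))
                  \<and> (\<forall>i \<in> {1..k + 1}. \<forall>j \<in> {1..k + 1}.
                       i \<noteq> j \<longrightarrow> \<not> same_point (t i, u i) (t j, u j)) \<longrightarrow>
                  (\<exists>c :: nat \<Rightarrow> 'a.
                     q = (\<Sum>i = 1..k + 1.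
                            const (c i) * (const (t i) * var_x + const (u i) * var_y) ^ d)))"
      if v: "v \<in> carrier_vec (k + 2)" "v \<noteq> 0\<^sub>v (k + 2)" "M *\<^sub>v v = 0\<^sub>v (d - k)"
        and F: "F = (\<Sum>i\<le>k + 1. const (v $ i) * var_x ^ (k + 1 - i) * var_y ^ i)" for v F
    proof (intro conjI impI allI)
      define g where "g = poly_of_coeffs v"
      have g: "g \<noteq> 0" "annihilates d Z a g"
        using poly_of_coeffs_eq_0_iff[OF v(1)] ker[OF v(1)] v(2,3) by (auto simp: g_def)
      have gdeg: "degree g \<le> a" using g(2) by (rule annihilates_degree)
      have ming: "minimal_annihilator d Z a g" using min g by (simp add: minimal_annihilator_def)
      have "F = bform a (\<lambda>i. v $ i)" using F ak by (simp add: bform_def)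
      also have "\<dots> = bform a (coeff g)"
        using v(1) sa by (intro bform_cong) (auto simp: g_def coeff_poly_of_coeffs)
      finally have Fg: "F = bform a (coeff g)" .
      note multiple = multiple_root_iff[OF g(1) gdeg, folded Fg]
      {
        assume "\<nexists>P. is_multiple_root F P"
        hence "form_squarefree a g" using multiple by blast
        hence "power_sum d Z a" by (rule power_sum_of_annihilator[OF d g(2,1)])
        thus "form_rank d q = k + 1"
          unfolding q using lower a(1) ak by (intro form_rank_eqI) auto
      next
        assume "\<exists>P. is_multiple_root F P"
        hence "\<not> form_squarefree a g" using multiple by blast
        hence "d + 2 - a \<le> s" if "power_sum d Z s" for s
          using double_root_lower_bound[OF ming d _ that] by simp
        hence "form_rank d (form_of d Z) = d + 2 - a"
          using upper ad by (intro form_rank_eqI) auto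
        thus "form_rank d q = d - k + 1" using q ak ad' by simp
      next
        fix t u :: "nat \<Rightarrow> 'a"
        assume tu: "(\<forall>i \<in> {1..k + 1}. is_root F (t i, u i))
                  \<and> (\<forall>i \<in> {1..k + 1}. \<forall>j \<in> {1..k + 1}.
                       i \<noteq> j \<longrightarrow> \<not> same_point (t i, u i) (t j, u j))"
        define P where "P i = (t (Suc i), u (Suc i))" for i
        have root: "P i \<noteq> (0, 0)" "form_eval a g (P i) = 0" if "i < a" for i
        proof -
          have "is_root F (P i)" using tu that ak by (simp add: P_def)
          thus "P i \<noteq> (0, 0)" "form_eval a g (P i) = 0"
            using eval_form_bform[OF gdeg] by (simp_all add: is_root_def homogeneous_coords_def Fg)
        qed
        have "snd (P i) * fst (P j) \<noteq> fst (P i) * snd (P j)" if ij: "i < a" "j < a" "i \<noteq> j" for i j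
        proof
          assume "snd (P i) * fst (P j) = fst (P i) * snd (P j)"
          then obtain c where "c \<noteq> 0" "fst (P j) = c * fst (P i)" "snd (P j) = c * snd (P i)"
            using proportional_points root(1) ij by metis
          hence "same_point (P i) (P j)" unfolding same_point_def by blast
          thus False using tu ij ak by (auto simp: P_def)
        qed
        hence ind: "independent_points a P" using root(1) by (simp add: independent_points_def)
        obtain h where h: "degree h + a \<le> a" "g = (\<Prod>i<a. lin (P i)) * h"
          using form_roots_factor[OF gdeg le_refl ind root(2)] by blast
        obtain b where b: "h = [:b:]" using h(1) degree0_coeffs by auto
        have "b \<noteq> 0" using g(1) h(2) b by auto
        hence "(\<Prod>i<a. lin (P i)) = Polynomial.smult (1 / b) g" using h(2) b by simp
        hence "annihilates d Z a (\<Prod>i<a. lin (P i))" using annihilates_smult[OF g(2)] by metis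
        then obtain c where c: "\<forall>j\<le>d. Z j = (\<Sum>i<a. c i * power_seq d (P i) j)"
          using apolarity[OF ind] by blast
        have "q = form_of d (\<lambda>j. \<Sum>i<a. c i * power_seq d (P i) j)"
          unfolding q form_of_eq_iff using c .
        also have "\<dots> = (\<Sum>i<a. const (c i) * (const (t (Suc i)) * var_x + const (u (Suc i)) * var_y) ^ d)"
          by (simp add: form_of_sum form_of_scale form_of_power_seq P_def)
        also have "\<dots> = (\<Sum>i = 1..k + 1. const (c (i - 1)) * (const (t i) * var_x + const (u i) * var_y) ^ d)"
          using ak by (intro sum.reindex_bij_witness[of _ "\<lambda>i. i - 1" Suc]) auto
        finally show "\<exists>c. q = (\<Sum>i = 1..k + 1. const (c i) * (const (t i) * var_x + const (u i) * var_y) ^ d)"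
          by (rule exI[of _ "\<lambda>i. c (i - 1)"])
      }
    qed
    show ?thesis using rank kernel forms by blast
  qed
  show ?thesis using part_i part_ii part_iii by blast
qed

end
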